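(* Let $G$ be an $r$-regular graph with $n$ vertices. Let $c_3$, $c_4$ and $c_5$ denote the numbers of subgraphs of $G$ that are cycles on $3$, $4$ and $5$ vertices, respectively, and let $q$ denote the number of subgraphs of $G$ isomorphic to $Q$, where $Q$ is the graph on $4$ vertices with $5$ edges (that is, $K_4$ with one edge removed). Then the number $\rho(G,5)$ of $5$-matchings of $G$ is $$\begin{aligned} \rho(G,5)={}&\frac{nr}{3840}\Big(n^4r^4-40n^3r^4+640n^2r^4-4960nr^4+16128r^4+20n^3r^3-720n^2r^3+9440nr^3-46080r^3\\ &\qquad\quad+220n^2r^2-6400nr^2+51840r^2+1520nr-26880r+5376\Big)\\ &+\Big(\frac{-5n^2r^2+140nr^2-1080r^2-130nr+2160r-1080}{40}\Big)c_3+\Big(\frac{nr}{2}-8r+8\Big)c_4-c_5+4q . \end{aligned}$$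
   Context: Graphs are finite and simple. A $k$-matching in a graph $G$ is a set of $k$ edges of $G$, no two of which share a vertex; $\rho(G,k)$ denotes the number of $k$-matchings of $G$. Subgraphs are counted as (not necessarily induced) subgraphs, i.e. as distinct edge subsets of $G$ forming a copy of the given graph. *)

theory Defs
  imports Complex_Main
begin

text \<open>A graph is given by its vertex set and its edge set, edges being two-element vertex sets.\<close>

definition simple_graph :: "'a set \<Rightarrow> 'a set set \<Rightarrow> bool" where
  "simple_graph V E \<longleftrightarrow> finite V \<and> (\<forall>e\<in>E. e \<subseteq> V \<and> card e = 2)"

definition degree :: "'a set set \<Rightarrow> 'a \<Rightarrow> nat" where
  "degree E v = card {e \<in> E. v \<in> e}"

definition regular_graph :: "nat \<Rightarrow> 'a set \<Rightarrow> 'a set set \<Rightarrow> bool" where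
  "regular_graph r V E \<longleftrightarrow> simple_graph V E \<and> (\<forall>v\<in>V. degree E v = r)"

definition matchings :: "'a set set \<Rightarrow> nat \<Rightarrow> 'a set set set" where
  "matchings E k = {M. M \<subseteq> E \<and> card M = k \<and> pairwise disjnt M}"

definition num_matchings :: "'a set set \<Rightarrow> nat \<Rightarrow> nat" where
  "num_matchings E k = card (matchings E k)"

definition graph_iso :: "'a set \<Rightarrow> 'a set set \<Rightarrow> 'b set \<Rightarrow> 'b set set \<Rightarrow> bool" where
  "graph_iso V E W F \<longleftrightarrow> (\<exists>f. bij_betw f V W \<and> F = (\<lambda>e. f ` e) ` E)"

text \<open>Copies of \<open>(W, F)\<close> in \<open>(V, E)\<close> are identified with their edge sets. This is the usual count
  of (not necessarily induced) subgraphs as long as \<open>(W, F)\<close> has no isolated vertices.\<close>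

definition copies :: "'a set \<Rightarrow> 'a set set \<Rightarrow> 'b set \<Rightarrow> 'b set set \<Rightarrow> 'a set set set" where
  "copies V E W F = {E'. E' \<subseteq> E \<and> (\<exists>V'\<subseteq>V. graph_iso W F V' E')}"

definition num_copies :: "'a set \<Rightarrow> 'a set set \<Rightarrow> 'b set \<Rightarrow> 'b set set \<Rightarrow> nat" where
  "num_copies V E W F = card (copies V E W F)"

text \<open>The cycle on the vertices \<open>0, \<dots>, k - 1\<close>; intended for \<open>k \<ge> 3\<close>.\<close>

definition cycle_edges :: "nat \<Rightarrow> nat set set" where
  "cycle_edges k = {{i, Suc i mod k} | i. i < k}"

definition num_cycles :: "'a set \<Rightarrow> 'a set set \<Rightarrow> nat \<Rightarrow> nat" where
  "num_cycles V E k = num_copies V E {..<k} (cycle_edges k)"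

definition complete_edges :: "nat \<Rightarrow> nat set set" where
  "complete_edges k = {e. e \<subseteq> {..<k} \<and> card e = 2}"

definition Q_edges :: "nat set set" where
  "Q_edges = complete_edges 4 - {{2, 3}}"

definition num_Q :: "'a set \<Rightarrow> 'a set set \<Rightarrow> nat" where
  "num_Q V E = num_copies V E {..<4} Q_edges"

end

theory Submission
  imports Defs
begin

text \<open>
  The proof reads the matching numbers off closed walks. By Godsil's theorem, the logarithmic
  derivative of the matching polynomial of a graph is the generating function of the closed walks
  in its path trees: the path tree at \<open>v\<close> has the paths starting at \<open>v\<close> as nodes, each joined to its
  extensions by one vertex. Comparing coefficients yields Newton's identities
  (\<open>newton_identity\<close>), in which the matching numbers are the elementary symmetric functions and the
  numbers \<open>\<Sum>v\<in>V. walks E i [v]\<close> of closed walks of length \<open>2 * i\<close> from the roots are twice the power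
  sums. So the number of 5-matchings is a polynomial in the walk counts for \<open>i = 1, \<dots>, 5\<close>.

  In an \<open>r\<close>-regular graph the path tree is nearly the \<open>r\<close>-regular tree: a node that is not the root
  has \<open>r - 1\<close> children, minus one for every chord from the end point of the path to an earlier vertex
  of the path (\<open>card_extensions\<close>). A closed walk of length at most 10 reaches depth at most 5, so
  only chords of paths with at most four edges count, and these close cycles of length 3, 4 and 5.
  Pairs of chords, and pairs of triangles sharing an edge, form copies of \<open>Q\<close>. All larger
  configurations reduce to these, because a path with a pendant edge or two beyond a cycle is counted
  by extending a shorter path. Evaluating the walk counts level by level (\<open>path_sum_4_walks\<close> to
  \<open>path_sum_0_walks\<close>) therefore gives polynomials in \<open>n\<close> and \<open>r\<close> with linear corrections in \<open>c3\<close>,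
  \<open>c4\<close>, \<open>c5\<close> and \<open>q\<close> (\<open>power_sums\<close>), and inserting them into Newton's identities proves the formula.

  Paths with prescribed chords are embeddings of a cycle or of \<open>Q\<close>; each subgraph is hit by as many
  embeddings as the pattern has automorphisms (\<open>card_embeddings\<close>), which explains the factors
  6, 8, 10 and 4.
\<close>

section \<open>Matchings and deletion of vertices\<close>

definition nbrs :: "'a set set \<Rightarrow> 'a \<Rightarrow> 'a set" where
  "nbrs E v = {u. {v, u} \<in> E}"

text \<open>Deleting the vertex set \<open>S\<close> is done on the edges alone; the vertices of \<open>S\<close> stay as isolated
  vertices, which do not affect matchings.\<close>

definition avoiding :: "'a set set \<Rightarrow> 'a set \<Rightarrow> 'a set set" where
  "avoiding E S = {e \<in> E. e \<inter> S = {}}"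

lemma simple_graph_finite: "simple_graph V E \<Longrightarrow> finite E"
  unfolding simple_graph_def by (rule finite_subset[of _ "Pow V"]) auto

lemma nbrs_subset: "simple_graph V E \<Longrightarrow> nbrs E v \<subseteq> V"
  unfolding simple_graph_def nbrs_def by auto

lemma finite_nbrs: "simple_graph V E \<Longrightarrow> finite (nbrs E v)"
  using nbrs_subset finite_subset unfolding simple_graph_def by metis

lemma not_self_nbr: "simple_graph V E \<Longrightarrow> v \<notin> nbrs E v"
  unfolding simple_graph_def nbrs_def by fastforce

lemma simple_graph_avoiding: "simple_graph V E \<Longrightarrow> simple_graph V (avoiding E S)"
  unfolding simple_graph_def avoiding_def by auto

lemma avoiding_avoiding: "avoiding (avoiding E S) T = avoiding E (S \<union> T)"
  unfolding avoiding_def by auto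

lemma avoiding_empty [simp]: "avoiding E {} = E"
  by (simp add: avoiding_def)

lemma nbrs_avoiding: "v \<notin> S \<Longrightarrow> nbrs (avoiding E S) v = nbrs E v - S"
  unfolding nbrs_def avoiding_def by auto

lemma finite_matchings: "finite E \<Longrightarrow> finite (matchings E k)"
  unfolding matchings_def by (rule finite_subset[of _ "Pow E"]) auto

lemma num_matchings_0 [simp]: "num_matchings E 0 = 1" if "finite E"
proof -
  have "matchings E 0 = {{}}"
    using that by (auto simp: matchings_def dest: finite_subset)
  then show ?thesis by (simp add: num_matchings_def)
qed

lemma matchings_avoiding:
  "matchings (avoiding E S) k = {M \<in> matchings E k. \<Union>M \<inter> S = {}}"
  unfolding matchings_def avoiding_def by auto

lemma edge_at_vertex:
  assumes "simple_graph V E" "e \<in> E" "v \<in> e"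
  obtains u where "e = {v, u}" "u \<noteq> v"
proof -
  have "card e = 2" using assms by (auto simp: simple_graph_def)
  then show ?thesis using that \<open>v \<in> e\<close> by (auto simp: card_2_iff doubleton_eq_iff)
qed

text \<open>The matchings that cover \<open>v\<close> are sorted by the partner \<open>u\<close> of \<open>v\<close>.\<close>

lemma num_matchings_delete_vertex:
  assumes G: "simple_graph V E"
  shows "num_matchings E (Suc k) = num_matchings (avoiding E {v}) (Suc k)
           + (\<Sum>u\<in>nbrs E v. num_matchings (avoiding E {v, u}) k)"
proof -
  define ext where "ext u = insert {v, u} ` matchings (avoiding E {v, u}) k" for u
  have finE: "finite E" using G by (rule simple_graph_finite)
  have fin: "finite (matchings (avoiding E S) j)" for S j
    by (intro finite_matchings simple_graph_finite[OF simple_graph_avoiding[OF G]])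
  have split: "matchings E (Suc k) = matchings (avoiding E {v}) (Suc k) \<union> (\<Union>u\<in>nbrs E v. ext u)"
    (is "?L = ?A \<union> ?B")
  proof
    show "?L \<subseteq> ?A \<union> ?B"
    proof
      fix M assume M: "M \<in> ?L"
      show "M \<in> ?A \<union> ?B"
      proof (cases "v \<in> \<Union>M")
        case False
        then show ?thesis using M by (auto simp: matchings_avoiding)
      next
        case True
        then obtain e where e: "e \<in> M" "v \<in> e" by blast
        have "e \<in> E" using e M by (auto simp: matchings_def)
        then obtain u where u: "e = {v, u}" using edge_at_vertex[OF G _ e(2)] by metis
        have "finite M" using M finE by (auto simp: matchings_def dest: finite_subset)
        have disj: "f \<inter> {v, u} = {}" if "f \<in> M - {e}" for f
          using M e that u unfolding matchings_def pairwise_def disjnt_def by auto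
        have "M - {e} \<in> matchings (avoiding E {v, u}) k"
          using M e disj \<open>finite M\<close> pairwise_subset[of disjnt M "M - {e}"]
          unfolding matchings_def avoiding_def by (auto simp: card_Diff_singleton)
        moreover have "insert {v, u} (M - {e}) = M" using e u by auto
        ultimately have "M \<in> ext u" unfolding ext_def by (metis image_eqI)
        moreover have "u \<in> nbrs E v" using \<open>e \<in> E\<close> u by (simp add: nbrs_def)
        ultimately show ?thesis by blast
      qed
    qed
    show "?A \<union> ?B \<subseteq> ?L"
    proof -
      have "?A \<subseteq> ?L" by (auto simp: matchings_avoiding)
      moreover have "insert {v, u} M \<in> ?L"
        if "u \<in> nbrs E v" "M \<in> matchings (avoiding E {v, u}) k" for u M
      proof -
        have M: "M \<subseteq> E" "card M = k" "pairwise disjnt M" "\<Union>M \<inter> {v, u} = {}"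
          using that(2) by (simp_all add: matchings_avoiding) (auto simp: matchings_def)
        have "{v, u} \<notin> M" using M by auto
        moreover have "finite M" using M finE finite_subset by blast
        moreover have "pairwise disjnt (insert {v, u} M)"
          unfolding pairwise_insert using M by (simp add: disjnt_def)
        ultimately show ?thesis using M that(1) by (simp add: matchings_def nbrs_def)
      qed
      ultimately show ?thesis unfolding ext_def by auto
    qed
  qed
  have "?A \<inter> ?B = {}" unfolding ext_def matchings_avoiding by auto
  moreover have "finite ?B"
    unfolding ext_def using fin finite_nbrs[OF G] by auto
  ultimately have "card ?L = card ?A + card ?B"
    unfolding split by (intro card_Un_disjoint fin)
  moreover have "card ?B = (\<Sum>u\<in>nbrs E v. card (ext u))"
  proof (rule card_UN_disjoint)
    show "\<forall>u\<in>nbrs E v. \<forall>u'\<in>nbrs E v. u \<noteq> u' \<longrightarrow> ext u \<inter> ext u' = {}"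
    proof (intro ballI impI)
      fix u u' assume "u \<in> nbrs E v" "u' \<in> nbrs E v" and ne: "u \<noteq> u'"
      have "False" if M: "M \<in> matchings (avoiding E {v, u}) k"
        "M' \<in> matchings (avoiding E {v, u'}) k"
        and eq: "insert {v, u} M = insert {v, u'} M'" for M M'
      proof -
        have "{v, u} \<in> insert {v, u'} M'" using eq by blast
        moreover have "{v, u} \<noteq> {v, u'}" using ne by (auto simp: doubleton_eq_iff)
        ultimately show False using M(2) by (auto simp: matchings_avoiding)
      qed
      then show "ext u \<inter> ext u' = {}" unfolding ext_def by blast
    qed
  qed (auto simp: ext_def fin finite_nbrs[OF G])
  moreover have "card (ext u) = num_matchings (avoiding E {v, u}) k" for u
    unfolding ext_def num_matchings_def
  proof (rule card_image, rule inj_onI)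
    fix M M' assume "M \<in> matchings (avoiding E {v, u}) k" "M' \<in> matchings (avoiding E {v, u}) k"
      and eq: "insert {v, u} M = insert {v, u} M'"
    then have "{v, u} \<notin> M" "{v, u} \<notin> M'" by (auto simp: matchings_avoiding)
    then show "M = M'" using eq by (rule insert_ident[THEN iffD1])
  qed
  ultimately show ?thesis by (simp add: num_matchings_def)
qed

lemma card_vertices_of_matching:
  assumes G: "simple_graph V E" and M: "M \<in> matchings E k"
  shows "card (\<Union>M) = 2 * k"
proof -
  have edges: "finite e" "card e = 2" if "e \<in> M" for e
    using that G M by (auto simp: simple_graph_def matchings_def intro: finite_subset)
  have "card (\<Union>M) = sum card M"
    using M edges by (intro card_Union_disjoint) (auto simp: matchings_def)
  also have "\<dots> = 2 * k" using edges M by (simp add: matchings_def)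
  finally show ?thesis .
qed

text \<open>Double counting of the pairs \<open>(v, M)\<close> in which \<open>M\<close> misses \<open>v\<close>: a \<open>k\<close>-matching misses all but
  \<open>2 * k\<close> vertices.\<close>

lemma sum_num_matchings_delete_vertex:
  assumes G: "simple_graph V E"
  shows "(\<Sum>v\<in>V. real (num_matchings (avoiding E {v}) k))
           = (real (card V) - 2 * real k) * real (num_matchings E k)"
proof -
  have finV: "finite V" and finM: "finite (matchings E k)"
    using G finite_matchings[OF simple_graph_finite[OF G]] by (auto simp: simple_graph_def)
  have uncovered: "real (card {v \<in> V. v \<notin> \<Union>M}) = real (card V) - 2 * real k"
    if M: "M \<in> matchings E k" for M
  proof -
    have sub: "\<Union>M \<subseteq> V" using M G by (auto simp: matchings_def simple_graph_def)
    have "{v \<in> V. v \<notin> \<Union>M} = V - \<Union>M" by auto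
    then have "card {v \<in> V. v \<notin> \<Union>M} = card V - 2 * k"
      using card_Diff_subset[OF finite_subset[OF sub finV] sub] card_vertices_of_matching[OF G M]
      by simp
    moreover have "2 * k \<le> card V"
      using card_mono[OF finV sub] card_vertices_of_matching[OF G M] by simp
    ultimately show ?thesis by (simp add: of_nat_diff)
  qed
  have "(\<Sum>v\<in>V. real (num_matchings (avoiding E {v}) k))
      = (\<Sum>v\<in>V. \<Sum>M\<in>matchings E k. of_bool (v \<notin> \<Union>M))"
    unfolding num_matchings_def matchings_avoiding
    by (intro sum.cong refl) (simp add: finM of_bool_def sum.If_cases Int_def)
  also have "\<dots> = (\<Sum>M\<in>matchings E k. \<Sum>v\<in>V. of_bool (v \<notin> \<Union>M))"
    by (rule sum.swap)
  also have "\<dots> = (\<Sum>M\<in>matchings E k. real (card {v \<in> V. v \<notin> \<Union>M}))"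
    by (intro sum.cong refl) (simp add: finV of_bool_def sum.If_cases Int_def)
  also have "\<dots> = (real (card V) - 2 * real k) * real (num_matchings E k)"
    using uncovered by (simp add: num_matchings_def)
  finally show ?thesis .
qed

section \<open>Closed walks in path trees and Newton's identities\<close>

text \<open>Let \<open>p\<close> be a path written backwards, so that its head is the current end point. Then
  \<open>walks E k p\<close> is the number of closed walks of length \<open>2 * k\<close> from the root of the path tree of
  \<open>p\<close>: its nodes are the paths that extend \<open>p\<close>, and a node is joined to its one-vertex
  extensions. The recursion splits a walk at its first return to the root: the walk goes down to a
  child \<open>u # p\<close>, makes a closed walk of length \<open>2 * i\<close> there, comes back and continues.\<close>

function walks :: "'a set set \<Rightarrow> nat \<Rightarrow> 'a list \<Rightarrow> real" where
  "walks E 0 p = 1"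
| "walks E (Suc k) p =
     (\<Sum>i\<le>k. (\<Sum>u\<in>nbrs E (hd p) - set p. walks E i (u # p)) * walks E (k - i) p)"
  by pat_completeness auto
termination by (relation "measure (\<lambda>(E, k, p). k)") auto

text \<open>In terms of the generating functions \<open>M S t = (\<Sum>k. m S k * t ^ k)\<close> of the matchings avoiding \<open>S\<close>
  and \<open>w p t = (\<Sum>k. walks E k p * t ^ k)\<close>, this is
  \<open>M (set (v # p)) t = w (v # p) (- t) * M (set p) t\<close>. The quotient of the two \<open>M\<close> satisfies, by
  deletion of a vertex, the same continued fraction recursion as the walks in the path tree.\<close>

lemma num_matchings_walks:
  assumes G: "simple_graph V E" and "v \<notin> set p"
  shows "real (num_matchings (avoiding E (set (v # p))) k) =
    (\<Sum>i\<le>k. (-1) ^ i * walks E i (v # p) * real (num_matchings (avoiding E (set p)) (k - i)))"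
  using assms(2)
proof (induction k arbitrary: v p rule: less_induct)
  case (less k)
  let ?m = "\<lambda>S j. real (num_matchings (avoiding E S) j)"
  let ?S = "set p" and ?N = "nbrs E v - set (v # p)"
  show ?case
  proof (cases k)
    case 0
    then show ?thesis
      using simple_graph_finite[OF simple_graph_avoiding[OF G]] by simp
  next
    case (Suc l)
    define a where "a i = (\<Sum>u\<in>?N. walks E i (u # v # p))" for i
    define b where "b j = (-1) ^ j * walks E j (v # p)" for j
    have nb: "nbrs (avoiding E ?S) v = ?N"
      using nbrs_avoiding[OF less.prems] not_self_nbr[OF G, of v] by auto
    have "?m ?S (Suc l) = ?m (insert v ?S) (Suc l) + (\<Sum>u\<in>?N. ?m (insert u (insert v ?S)) l)"
      using num_matchings_delete_vertex[OF simple_graph_avoiding[OF G, of ?S], of l v]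
      unfolding nb avoiding_avoiding by (simp add: insert_commute)
    moreover have "(\<Sum>u\<in>?N. ?m (insert u (insert v ?S)) l)
        = (\<Sum>i\<le>l. (-1) ^ i * a i * ?m (insert v ?S) (l - i))"
    proof -
      have "(\<Sum>u\<in>?N. ?m (insert u (insert v ?S)) l)
          = (\<Sum>u\<in>?N. \<Sum>i\<le>l. (-1) ^ i * walks E i (u # v # p) * ?m (insert v ?S) (l - i))"
        using less.IH[of l _ "v # p"] Suc by (intro sum.cong refl) simp
      also have "\<dots> = (\<Sum>i\<le>l. \<Sum>u\<in>?N. (-1) ^ i * walks E i (u # v # p) * ?m (insert v ?S) (l - i))"
        by (rule sum.swap)
      finally show ?thesis by (simp add: a_def sum_distrib_left sum_distrib_right)
    qed
    moreover have "(\<Sum>i\<le>l. (-1) ^ i * a i * ?m (insert v ?S) (l - i))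
        = (\<Sum>i\<le>l. \<Sum>j\<le>l - i. (-1) ^ i * a i * (b j * ?m ?S (l - (i + j))))"
      using less.IH[of _ v p] less.prems Suc
      by (intro sum.cong refl) (simp add: b_def sum_distrib_left diff_diff_eq)
    moreover have "(\<Sum>i\<le>l. \<Sum>j\<le>l - i. (-1) ^ i * a i * (b j * ?m ?S (l - (i + j))))
        = (\<Sum>t\<le>l. \<Sum>i\<le>t. (-1) ^ i * a i * (b (t - i) * ?m ?S (l - t)))"
    proof -
      have "(SIGMA i:{..l}. {..l - i}) = {(i, j). i + j \<le> l}" by auto
      then show ?thesis
        using sum.triangle_reindex_eq[of "\<lambda>i j. (-1) ^ i * a i * (b j * ?m ?S (l - (i + j)))" l]
        by (simp add: sum.Sigma)
    qed
    moreover have "(\<Sum>t\<le>l. \<Sum>i\<le>t. (-1) ^ i * a i * (b (t - i) * ?m ?S (l - t)))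
        = (\<Sum>t\<le>l. (-1) ^ t * walks E (Suc t) (v # p) * ?m ?S (l - t))"
    proof (intro sum.cong refl)
      fix t
      have "(-1) ^ i * a i * (b (t - i) * ?m ?S (l - t))
          = (-1) ^ t * (a i * walks E (t - i) (v # p)) * ?m ?S (l - t)" if "i \<le> t" for i
      proof -
        have "(-1) ^ i * (-1) ^ (t - i) = ((-1) ^ t :: real)"
          using that by (simp flip: power_add)
        then show ?thesis by (simp add: b_def algebra_simps)
      qed
      then show "(\<Sum>i\<le>t. (-1) ^ i * a i * (b (t - i) * ?m ?S (l - t)))
          = (-1) ^ t * walks E (Suc t) (v # p) * ?m ?S (l - t)"
        by (simp add: a_def sum_distrib_left sum_distrib_right)
    qed
    ultimately have "?m (insert v ?S) (Suc l)
        = ?m ?S (Suc l) - (\<Sum>t\<le>l. (-1) ^ t * walks E (Suc t) (v # p) * ?m ?S (l - t))"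
      by simp
    then show ?thesis
      by (simp add: Suc sum.atMost_Suc_shift sum_negf del: walks.simps(2) sum.atMost_Suc)
  qed
qed

text \<open>Newton's identities, with the sums \<open>\<Sum>v\<in>V. walks E i [v]\<close> as twice the power sums and the
  matching numbers as the elementary symmetric functions.\<close>

lemma newton_identity:
  assumes G: "simple_graph V E"
  shows "2 * real (Suc k) * real (num_matchings E (Suc k)) =
    (\<Sum>i\<le>k. (-1) ^ i * (\<Sum>v\<in>V. walks E (Suc i) [v]) * real (num_matchings E (k - i)))"
proof -
  let ?m = "\<lambda>j. real (num_matchings E j)"
  have "(real (card V) - 2 * real (Suc k)) * ?m (Suc k)
      = (\<Sum>v\<in>V. real (num_matchings (avoiding E {v}) (Suc k)))"
    using sum_num_matchings_delete_vertex[OF G] by simp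
  also have "\<dots> = (\<Sum>v\<in>V. \<Sum>i\<le>Suc k. (-1) ^ i * walks E i [v] * ?m (Suc k - i))"
    using num_matchings_walks[OF G, of _ "[]"] by simp
  also have "\<dots> = (\<Sum>v\<in>V. ?m (Suc k) - (\<Sum>i\<le>k. (-1) ^ i * walks E (Suc i) [v] * ?m (k - i)))"
    by (simp add: sum.atMost_Suc_shift sum_negf del: walks.simps(2) sum.atMost_Suc)
  also have "\<dots> = real (card V) * ?m (Suc k)
      - (\<Sum>v\<in>V. \<Sum>i\<le>k. (-1) ^ i * walks E (Suc i) [v] * ?m (k - i))"
    by (simp add: sum_subtractf del: walks.simps(2))
  also have "(\<Sum>v\<in>V. \<Sum>i\<le>k. (-1) ^ i * walks E (Suc i) [v] * ?m (k - i))
      = (\<Sum>i\<le>k. \<Sum>v\<in>V. (-1) ^ i * walks E (Suc i) [v] * ?m (k - i))"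
    by (rule sum.swap)
  finally show ?thesis
    by (simp add: sum_distrib_left sum_distrib_right algebra_simps del: walks.simps(2))
qed

section \<open>Counting copies by embeddings\<close>

text \<open>Embeddings of \<open>({..<k}, F)\<close> are encoded as the lists of the images of \<open>0, \<dots>, k - 1\<close>: this represents
  each map once, and it makes embeddings comparable with paths.\<close>

definition embeddings :: "nat \<Rightarrow> nat set set \<Rightarrow> 'a set set \<Rightarrow> 'a list set" where
  "embeddings k F E = {xs. length xs = k \<and> distinct xs \<and> (\<forall>e\<in>F. (!) xs ` e \<in> E)}"

definition automorphisms :: "nat \<Rightarrow> nat set set \<Rightarrow> nat list set" where
  "automorphisms k F =
     {s. length s = k \<and> distinct s \<and> set s = {..<k} \<and> (\<lambda>e. (!) s ` e) ` F = F}"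

text \<open>Two embeddings with the same image edges also have the same image vertices, because the pattern
  \<open>F\<close> covers \<open>{..<k}\<close>; hence they differ by an automorphism of \<open>F\<close>.\<close>

lemma card_embeddings_with_image:
  assumes F: "\<Union>F = {..<k}" and ys: "length ys = k" "distinct ys"
  shows "card {xs. length xs = k \<and> distinct xs
             \<and> (\<lambda>e. (!) xs ` e) ` F = (\<lambda>e. (!) ys ` e) ` F}
           = card (automorphisms k F)"
proof -
  let ?\<phi> = "\<lambda>xs. (\<lambda>e. (!) xs ` e) ` F"
  have vertices: "\<Union>(?\<phi> xs) = set xs" if "length xs = k" for xs :: "'b list"
  proof -
    have "\<Union>(?\<phi> xs) = (!) xs ` \<Union>F" by auto
    then show ?thesis using that by (simp add: F set_conv_nth image_def lessThan_def) blast
  qed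
  have sub: "e \<subseteq> {..<k}" if "e \<in> F" for e using that F by blast
  have inj: "inj_on ((!) ys) {..<k}" using ys by (simp add: inj_on_nth)
  have comp: "?\<phi> (map ((!) ys) s) = (\<lambda>e. (!) ys ` e) ` ((\<lambda>e. (!) s ` e) ` F)"
    if "length s = k" for s
  proof -
    have eq: "(!) (map ((!) ys) s) ` e = (!) ys ` (!) s ` e" if "e \<in> F" for e
      unfolding image_image using sub[OF that] \<open>length s = k\<close> by (intro image_cong) auto
    have "?\<phi> (map ((!) ys) s) = (\<lambda>e. (!) ys ` (!) s ` e) ` F"
      by (rule image_cong[OF refl]) (rule eq)
    then show ?thesis by (simp only: image_image)
  qed
  have "bij_betw (map ((!) ys)) (automorphisms k F)
          {xs. length xs = k \<and> distinct xs \<and> ?\<phi> xs = ?\<phi> ys}"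
    unfolding bij_betw_def
  proof
    show "inj_on (map ((!) ys)) (automorphisms k F)"
      using inj by (intro inj_on_mapI) (auto simp: automorphisms_def inj_on_def)
    show "map ((!) ys) ` automorphisms k F
        = {xs. length xs = k \<and> distinct xs \<and> ?\<phi> xs = ?\<phi> ys}" (is "?L = ?R")
    proof
      show "?L \<subseteq> ?R"
      proof
        fix xs assume "xs \<in> ?L"
        then obtain s where s: "s \<in> automorphisms k F" and xs: "xs = map ((!) ys) s" by blast
        have "distinct xs" using s inj by (simp add: xs distinct_map automorphisms_def)
        then show "xs \<in> ?R" using s comp[of s] by (simp add: xs automorphisms_def)
      qed
      show "?R \<subseteq> ?L"
      proof
        fix xs assume "xs \<in> ?R"
        then have xs: "length xs = k" "distinct xs" "?\<phi> xs = ?\<phi> ys" by auto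
        then have same: "set xs = set ys" using vertices ys by metis
        define g where "g = the_inv_into {..<k} ((!) ys)"
        have img: "(!) ys ` {..<k} = set ys" using ys by (auto simp: set_conv_nth)
        have g: "(!) ys (g x) = x" "g x \<in> {..<k}" if "x \<in> set xs" for x
          using f_the_inv_into_f[OF inj] the_inv_into_into[OF inj _ subset_refl] that
          unfolding g_def img same by auto
        define s where "s = map g xs"
        have ys_s: "map ((!) ys) s = xs" using g by (simp add: s_def map_idI)
        have "inj_on g (set xs)" using g by (metis inj_onI)
        then have s: "length s = k" "distinct s" "set s \<subseteq> {..<k}"
          using xs g by (auto simp: s_def distinct_map)
        have full: "set s = {..<k}"
          using s by (intro card_subset_eq) (simp_all add: distinct_card)
        have "(\<lambda>e. (!) ys ` e) ` ((\<lambda>e. (!) s ` e) ` F) = (\<lambda>e. (!) ys ` e) ` F"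
          using comp[OF s(1)] ys_s xs by simp
        moreover have "inj_on (\<lambda>e. (!) ys ` e) (Pow {..<k})"
          using inj by (rule inj_on_image_Pow)
        moreover have "(\<lambda>e. (!) s ` e) ` F \<subseteq> Pow {..<k}"
          using sub s full by (auto simp: subset_iff)
        moreover have "F \<subseteq> Pow {..<k}" using sub by auto
        ultimately have "(\<lambda>e. (!) s ` e) ` F = F"
          by (metis inj_on_image_eq_iff)
        then show "xs \<in> ?L" using s full ys_s by (auto simp: automorphisms_def)
      qed
    qed
  qed
  then show ?thesis by (simp add: bij_betw_same_card)
qed

text \<open>Sorting the embeddings by their image gives the orbit count: every copy is the image of as many
  embeddings as there are automorphisms.\<close>

lemma card_embeddings:
  assumes G: "simple_graph V E" and F: "\<Union>F = {..<k}"
  shows "card (embeddings k F E) = card (automorphisms k F) * num_copies V E {..<k} F"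
proof -
  let ?\<phi> = "\<lambda>xs. (\<lambda>e. (!) xs ` e) ` F"
  have V: "finite V" "\<And>e. e \<in> E \<Longrightarrow> e \<subseteq> V" using G by (auto simp: simple_graph_def)
  have inV: "set xs \<subseteq> V" if "xs \<in> embeddings k F E" for xs
  proof
    fix x assume "x \<in> set xs"
    moreover have "length xs = k" using that by (simp add: embeddings_def)
    ultimately obtain i where i: "i < k" "x = xs ! i" by (metis in_set_conv_nth)
    then obtain e where "e \<in> F" "i \<in> e" using F by (auto simp: set_eq_iff)
    then show "x \<in> V" using i that V by (auto simp: embeddings_def)
  qed
  have copies: "copies V E {..<k} F = ?\<phi> ` embeddings k F E"
  proof
    show "?\<phi> ` embeddings k F E \<subseteq> copies V E {..<k} F"
    proof
      fix E' assume "E' \<in> ?\<phi> ` embeddings k F E"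
      then obtain xs where xs: "xs \<in> embeddings k F E" and E': "E' = ?\<phi> xs" by blast
      have "bij_betw ((!) xs) {..<k} (set xs)"
        using xs by (auto simp: embeddings_def intro: bij_betw_nth)
      then show "E' \<in> copies V E {..<k} F"
        using xs inV[OF xs] unfolding copies_def graph_iso_def E' embeddings_def by blast
    qed
    show "copies V E {..<k} F \<subseteq> ?\<phi> ` embeddings k F E"
    proof
      fix E' assume "E' \<in> copies V E {..<k} F"
      then obtain f where "E' \<subseteq> E" and inj: "inj_on f {..<k}" and E': "E' = (\<lambda>e. f ` e) ` F"
        by (auto simp: copies_def graph_iso_def bij_betw_def)
      define xs where "xs = map f [0..<k]"
      have eq: "f ` e = (!) xs ` e" if "e \<in> F" for e
      proof (rule image_cong[OF refl])
        fix i assume "i \<in> e"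
        then have "i < k" using that F by blast
        then show "f i = xs ! i" by (simp add: xs_def)
      qed
      have "E' = ?\<phi> xs" unfolding E' by (rule image_cong[OF refl]) (rule eq)
      moreover have "xs \<in> embeddings k F E"
        using inj \<open>E' \<subseteq> E\<close> \<open>E' = ?\<phi> xs\<close>
        by (auto simp: embeddings_def xs_def distinct_map lessThan_atLeast0)
      ultimately show "E' \<in> ?\<phi> ` embeddings k F E" by blast
    qed
  qed
  have fin: "finite (embeddings k F E)"
    using inV V(1)
    by (intro finite_subset[OF _ finite_lists_length_eq[of V k]]) (auto simp: embeddings_def)
  have "card (embeddings k F E)
      = (\<Sum>E'\<in>?\<phi> ` embeddings k F E. card {xs \<in> embeddings k F E. ?\<phi> xs = E'})"
    unfolding card_eq_sum by (rule sum.image_gen[OF fin])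
  also have "\<dots> = (\<Sum>E'\<in>?\<phi> ` embeddings k F E. card (automorphisms k F))"
  proof (rule sum.cong[OF refl])
    fix E' assume "E' \<in> ?\<phi> ` embeddings k F E"
    then obtain ys where ys: "ys \<in> embeddings k F E" and E': "E' = ?\<phi> ys" by blast
    have "{xs \<in> embeddings k F E. ?\<phi> xs = E'}
        = {xs. length xs = k \<and> distinct xs \<and> ?\<phi> xs = ?\<phi> ys}"
    proof -
      have *: "xs \<in> embeddings k F E \<longleftrightarrow> length xs = k \<and> distinct xs \<and> ?\<phi> xs \<subseteq> E"
        for xs
        by (simp only: embeddings_def mem_Collect_eq image_subset_iff)
      then have "?\<phi> ys \<subseteq> E" using ys by blast
      then show ?thesis unfolding E' by (intro Collect_cong) (metis *)
    qed
    moreover have "length ys = k" "distinct ys" using ys by (auto simp: embeddings_def)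
    ultimately show "card {xs \<in> embeddings k F E. ?\<phi> xs = E'} = card (automorphisms k F)"
      by (simp only: card_embeddings_with_image[OF F])
  qed
  finally show ?thesis by (simp add: num_copies_def copies)
qed

lemma cycle_edges_explicit:
  "cycle_edges 3 = {{0, 1}, {1, 2}, {2, 0}}"
  "cycle_edges 4 = {{0, 1}, {1, 2}, {2, 3}, {3, 0}}"
  "cycle_edges 5 = {{0, 1}, {1, 2}, {2, 3}, {3, 4}, {4, 0}}"
proof -
  have *: "cycle_edges k = (\<lambda>i. {i, Suc i mod k}) ` {..<k}" for k
    by (auto simp: cycle_edges_def)
  have "{..<3} = {0, 1, 2::nat}" "{..<4} = {0, 1, 2, 3::nat}" "{..<5} = {0, 1, 2, 3, 4::nat}"
    by auto
  then show "cycle_edges 3 = {{0, 1}, {1, 2}, {2, 0}}"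
    "cycle_edges 4 = {{0, 1}, {1, 2}, {2, 3}, {3, 0}}"
    "cycle_edges 5 = {{0, 1}, {1, 2}, {2, 3}, {3, 4}, {4, 0}}"
    by (simp_all add: * flip: numeral_2_eq_2)
qed

lemma Q_edges_explicit: "Q_edges = {{0, 1}, {0, 2}, {0, 3}, {1, 2}, {1, 3}}"
proof -
  have "e \<in> complete_edges 4 \<longleftrightarrow> e \<in> {{0, 1}, {0, 2}, {0, 3}, {1, 2}, {1, 3}, {2, 3}}" for e
  proof
    assume "e \<in> complete_edges 4"
    then have e: "e \<subseteq> {..<4}" "card e = 2" by (auto simp: complete_edges_def)
    then obtain a b where ab: "e = {a, b}" "a \<noteq> b" by (auto simp: card_2_iff)
    then have "a < 4" "b < 4" using e(1) by auto
    then show "e \<in> {{0, 1}, {0, 2}, {0, 3}, {1, 2}, {1, 3}, {2, 3}}"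
      using ab(2) unfolding ab(1) insert_iff doubleton_eq_iff by simp arith
  next
    assume "e \<in> {{0, 1}, {0, 2}, {0, 3}, {1, 2}, {1, 3}, {2, 3}}"
    then show "e \<in> complete_edges 4"
      by (elim insertE emptyE) (simp_all add: complete_edges_def)
  qed
  then have "complete_edges 4 = {{0, 1}, {0, 2}, {0, 3}, {1, 2}, {1, 3}, {2, 3}}"
    by (rule set_eqI)
  then show ?thesis by (simp add: Q_edges_def insert_Diff_if doubleton_eq_iff)
qed

text \<open>An injective self-map of a finite graph that sends edges to edges is onto the edges. This form
  makes the automorphisms of the four patterns accessible to evaluation.\<close>

lemma automorphisms_eq_embeddings:
  assumes F: "\<Union>F = {..<k}"
  shows "automorphisms k F = embeddings k F F"
proof -
  have "set s = {..<k} \<and> (\<lambda>e. (!) s ` e) ` F = F"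
    if s: "length s = k" "distinct s" "\<forall>e\<in>F. (!) s ` e \<in> F" for s
  proof -
    have "set s \<subseteq> {..<k}"
    proof
      fix x assume "x \<in> set s"
      then obtain i where i: "i < k" "x = s ! i" using s(1) by (metis in_set_conv_nth)
      then obtain e where "e \<in> F" "i \<in> e" using F by (auto simp: set_eq_iff)
      then show "x \<in> {..<k}" using i s(3) F by blast
    qed
    then have "set s = {..<k}" using s by (intro card_subset_eq) (simp_all add: distinct_card)
    moreover have "F \<subseteq> Pow {..<k}" using F by auto
    moreover have "inj_on (\<lambda>e. (!) s ` e) (Pow {..<k})"
      using s by (intro inj_on_image_Pow inj_on_nth) auto
    moreover have "(\<lambda>e. (!) s ` e) ` F \<subseteq> F" using s(3) by blast
    ultimately show ?thesis
      using endo_inj_surj[of F "\<lambda>e. (!) s ` e"] finite_subset[of F "Pow {..<k}"]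
        inj_on_subset by blast
  qed
  then show ?thesis by (auto simp: automorphisms_def embeddings_def)
qed

lemma length_3_4_5:
  "length xs = 3 \<longleftrightarrow> (\<exists>a b c. xs = [a, b, c])"
  "length xs = 4 \<longleftrightarrow> (\<exists>a b c d. xs = [a, b, c, d])"
  "length xs = 5 \<longleftrightarrow> (\<exists>a b c d e. xs = [a, b, c, d, e])"
  by (auto simp: numeral_eq_Suc length_Suc_conv)

lemma embeddings_cycle_Q:
  "embeddings 3 (cycle_edges 3) E = {[a, b, c] | a b c. distinct [a, b, c]
     \<and> {a, b} \<in> E \<and> {b, c} \<in> E \<and> {c, a} \<in> E}"
  "embeddings 4 (cycle_edges 4) E = {[a, b, c, d] | a b c d. distinct [a, b, c, d]
     \<and> {a, b} \<in> E \<and> {b, c} \<in> E \<and> {c, d} \<in> E \<and> {d, a} \<in> E}"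
  "embeddings 5 (cycle_edges 5) E = {[a, b, c, d, e] | a b c d e. distinct [a, b, c, d, e]
     \<and> {a, b} \<in> E \<and> {b, c} \<in> E \<and> {c, d} \<in> E \<and> {d, e} \<in> E \<and> {e, a} \<in> E}"
  "embeddings 4 Q_edges E = {[a, b, c, d] | a b c d. distinct [a, b, c, d]
     \<and> {a, b} \<in> E \<and> {a, c} \<in> E \<and> {a, d} \<in> E \<and> {b, c} \<in> E \<and> {b, d} \<in> E}"
  unfolding embeddings_def cycle_edges_explicit Q_edges_explicit length_3_4_5
  by (auto simp del: distinct.simps)

text \<open>Each edge condition is tested as soon as both of its ends are chosen, which keeps the search
  small.\<close>

lemma embeddings_lists:
  fixes E :: "nat set set"
  assumes "\<Union>E \<subseteq> {..<k}"
  shows "embeddings 3 (cycle_edges 3) E =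
      set [[a, b, c]. a \<leftarrow> [0..<k], b \<leftarrow> [0..<k], {a, b} \<in> E,
        c \<leftarrow> [0..<k], {b, c} \<in> E, {c, a} \<in> E, distinct [a, b, c]]" (is ?t3)
    and "embeddings 4 (cycle_edges 4) E =
      set [[a, b, c, d]. a \<leftarrow> [0..<k], b \<leftarrow> [0..<k], {a, b} \<in> E,
        c \<leftarrow> [0..<k], {b, c} \<in> E, d \<leftarrow> [0..<k], {c, d} \<in> E, {d, a} \<in> E,
        distinct [a, b, c, d]]" (is ?t4)
    and "embeddings 5 (cycle_edges 5) E =
      set [[a, b, c, d, e]. a \<leftarrow> [0..<k], b \<leftarrow> [0..<k], {a, b} \<in> E,
        c \<leftarrow> [0..<k], {b, c} \<in> E, d \<leftarrow> [0..<k], {c, d} \<in> E,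
        e \<leftarrow> [0..<k], {d, e} \<in> E, {e, a} \<in> E, distinct [a, b, c, d, e]]" (is ?t5)
    and "embeddings 4 Q_edges E =
      set [[a, b, c, d]. a \<leftarrow> [0..<k], b \<leftarrow> [0..<k], {a, b} \<in> E,
        c \<leftarrow> [0..<k], {a, c} \<in> E, {b, c} \<in> E, d \<leftarrow> [0..<k], {a, d} \<in> E, {b, d} \<in> E,
        distinct [a, b, c, d]]" (is ?tq)
proof -
  have lt: "a < k" "b < k" if "{a, b} \<in> E" for a b
    using that assms by blast+
  show ?t3 unfolding embeddings_cycle_Q
    by (rule set_eqI) (auto simp del: distinct.simps dest: lt)
  show ?t4 unfolding embeddings_cycle_Q
    by (rule set_eqI) (auto simp del: distinct.simps dest: lt)
  show ?t5 unfolding embeddings_cycle_Q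
    by (rule set_eqI) (auto simp del: distinct.simps dest: lt)
  show ?tq unfolding embeddings_cycle_Q
    by (rule set_eqI) (auto simp del: distinct.simps dest: lt)
qed

lemma card_embeddings_self:
  "card (embeddings 3 (cycle_edges 3) (cycle_edges 3)) = 6"
  "card (embeddings 4 (cycle_edges 4) (cycle_edges 4)) = 8"
  "card (embeddings 5 (cycle_edges 5) (cycle_edges 5)) = 10"
  "card (embeddings 4 Q_edges Q_edges) = 4"
proof -
  have "\<Union>(cycle_edges 3) \<subseteq> {..<3}" "\<Union>(cycle_edges 4) \<subseteq> {..<4}"
    "\<Union>(cycle_edges 5) \<subseteq> {..<5}" "\<Union>Q_edges \<subseteq> {..<4}"
    by (auto simp: cycle_edges_explicit Q_edges_explicit)
  note L = embeddings_lists(1)[OF this(1)] embeddings_lists(2)[OF this(2)]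
    embeddings_lists(3)[OF this(3)] embeddings_lists(4)[OF this(4)]
  show "card (embeddings 3 (cycle_edges 3) (cycle_edges 3)) = 6"
    unfolding L unfolding cycle_edges_explicit by code_simp
  show "card (embeddings 4 (cycle_edges 4) (cycle_edges 4)) = 8"
    unfolding L unfolding cycle_edges_explicit by code_simp
  show "card (embeddings 5 (cycle_edges 5) (cycle_edges 5)) = 10"
    unfolding L unfolding cycle_edges_explicit by code_simp
  show "card (embeddings 4 Q_edges Q_edges) = 4"
    unfolding L unfolding Q_edges_explicit by code_simp
qed

lemma card_embeddings_cycle_Q:
  assumes "simple_graph V E"
  shows "card (embeddings 3 (cycle_edges 3) E) = 6 * num_cycles V E 3"
    and "card (embeddings 4 (cycle_edges 4) E) = 8 * num_cycles V E 4"
    and "card (embeddings 5 (cycle_edges 5) E) = 10 * num_cycles V E 5"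
    and "card (embeddings 4 Q_edges E) = 4 * num_Q V E"
proof -
  have "\<Union>(cycle_edges 3) = {..<3}" "\<Union>(cycle_edges 4) = {..<4}"
    "\<Union>(cycle_edges 5) = {..<5}" "\<Union>Q_edges = {..<4}"
    by (auto simp: cycle_edges_explicit Q_edges_explicit)
  then show "card (embeddings 3 (cycle_edges 3) E) = 6 * num_cycles V E 3"
    "card (embeddings 4 (cycle_edges 4) E) = 8 * num_cycles V E 4"
    "card (embeddings 5 (cycle_edges 5) E) = 10 * num_cycles V E 5"
    "card (embeddings 4 Q_edges E) = 4 * num_Q V E"
    using card_embeddings[OF assms] card_embeddings_self
    by (simp_all add: num_cycles_def num_Q_def automorphisms_eq_embeddings)
qed

section \<open>Paths and their chords\<close>

text \<open>Paths with \<open>k\<close> edges, written backwards as required by \<open>walks\<close>.\<close>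

fun paths :: "'a set \<Rightarrow> 'a set set \<Rightarrow> nat \<Rightarrow> 'a list set" where
  "paths V E 0 = (\<lambda>v. [v]) ` V"
| "paths V E (Suc k) = {u # p | u p. p \<in> paths V E k \<and> u \<in> nbrs E (hd p) - set p}"

definition chord :: "'a set set \<Rightarrow> nat \<Rightarrow> nat \<Rightarrow> 'a list \<Rightarrow> real" where
  "chord E i j p = of_bool ({p ! i, p ! j} \<in> E)"

lemma chord_Cons [simp]: "chord E (Suc i) (Suc j) (u # p) = chord E i j p"
  by (simp add: chord_def)

lemma chord_square [simp]: "chord E i j p * chord E i j p = chord E i j p"
  by (simp add: chord_def)

lemma paths_iff:
  assumes G: "simple_graph V E"
  shows "p \<in> paths V E k \<longleftrightarrow> length p = Suc k \<and> distinct p \<and> set p \<subseteq> V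
           \<and> successively (\<lambda>a b. {a, b} \<in> E) p"
proof (induction k arbitrary: p)
  case 0
  show ?case by (auto simp: length_Suc_conv)
next
  have V: "a \<in> V" "b \<in> V" if "{a, b} \<in> E" for a b
    using that G by (auto simp: simple_graph_def)
  case (Suc k)
  have "p \<in> paths V E (Suc k) \<longleftrightarrow> (\<exists>u q. p = u # q \<and> q \<in> paths V E k \<and> {hd q, u} \<in> E \<and> u \<notin> set q)"
    by (auto simp: nbrs_def)
  also have "\<dots> \<longleftrightarrow> length p = Suc (Suc k) \<and> distinct p \<and> set p \<subseteq> V
           \<and> successively (\<lambda>a b. {a, b} \<in> E) p"
    unfolding Suc.IH by (auto simp: length_Suc_conv insert_commute dest: V)
  finally show ?case .
qed

declare paths.simps [simp del]

lemma finite_paths: "simple_graph V E \<Longrightarrow> finite (paths V E k)"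
  by (rule finite_subset[OF _ finite_lists_length_eq[of V "Suc k"]])
    (auto simp: paths_iff simple_graph_def)

lemma sum_paths_Suc:
  assumes G: "simple_graph V E"
  shows "(\<Sum>p\<in>paths V E (Suc k). f p)
           = (\<Sum>p\<in>paths V E k. \<Sum>u\<in>nbrs E (hd p) - set p. f (u # p))"
proof -
  have "(\<Sum>p\<in>paths V E (Suc k). f p)
      = (\<Sum>x\<in>(SIGMA p:paths V E k. nbrs E (hd p) - set p). f (snd x # fst x))"
    by (rule sum.reindex_bij_witness[of _ "\<lambda>(p, u). u # p" "\<lambda>q. (tl q, hd q)"])
      (auto simp: paths.simps)
  also have "\<dots> = (\<Sum>p\<in>paths V E k. \<Sum>u\<in>nbrs E (hd p) - set p. f (u # p))"
    using finite_paths[OF G] finite_nbrs[OF G]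
    by (subst sum.Sigma) (auto simp: case_prod_beta)
  finally show ?thesis .
qed

lemma sum_paths_rev:
  assumes G: "simple_graph V E"
  shows "(\<Sum>p\<in>paths V E k. f p) = (\<Sum>p\<in>paths V E k. f (rev p))"
proof -
  have "rev p \<in> paths V E k" if "p \<in> paths V E k" for p
    using that by (simp add: paths_iff[OF G] successively_rev insert_commute)
  then show ?thesis
    by (intro sum.reindex_bij_witness[of _ rev rev]) auto
qed

lemma chord_rev:
  assumes "simple_graph V E" "p \<in> paths V E k" "i \<le> k" "j \<le> k"
  shows "chord E i j (rev p) = chord E (k - j) (k - i) p"
  using assms by (simp add: chord_def paths_iff rev_nth insert_commute)

lemma paths_explicit:
  assumes "simple_graph V E"
  shows "paths V E 1 = {[b, a] | a b. distinct [b, a] \<and> {b, a} \<in> E}"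
    and "paths V E 2 = {[c, b, a] | a b c. distinct [c, b, a] \<and> {c, b} \<in> E \<and> {b, a} \<in> E}"
    and "paths V E 3 = {[d, c, b, a] | a b c d. distinct [d, c, b, a]
           \<and> {d, c} \<in> E \<and> {c, b} \<in> E \<and> {b, a} \<in> E}"
    and "paths V E 4 = {[e, d, c, b, a] | a b c d e. distinct [e, d, c, b, a]
           \<and> {e, d} \<in> E \<and> {d, c} \<in> E \<and> {c, b} \<in> E \<and> {b, a} \<in> E}"
proof -
  have "a \<in> V" "b \<in> V" if "{a, b} \<in> E" for a b
    using that assms by (auto simp: simple_graph_def)
  note V = this
  have len: "length p = Suc 1 \<longleftrightarrow> (\<exists>a b. p = [a, b])"
    "length p = Suc 2 \<longleftrightarrow> (\<exists>a b c. p = [a, b, c])"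
    "length p = Suc 3 \<longleftrightarrow> (\<exists>a b c d. p = [a, b, c, d])"
    "length p = Suc 4 \<longleftrightarrow> (\<exists>a b c d e. p = [a, b, c, d, e])" for p :: "'a list"
    by (auto simp: numeral_eq_Suc length_Suc_conv)
  show "paths V E 1 = {[b, a] | a b. distinct [b, a] \<and> {b, a} \<in> E}"
    unfolding set_eq_iff paths_iff[OF assms] len
    by (auto simp del: distinct.simps dest: V)
  show "paths V E 2 = {[c, b, a] | a b c. distinct [c, b, a] \<and> {c, b} \<in> E \<and> {b, a} \<in> E}"
    unfolding set_eq_iff paths_iff[OF assms] len
    by (auto simp del: distinct.simps dest: V)
  show "paths V E 3 = {[d, c, b, a] | a b c d. distinct [d, c, b, a]
           \<and> {d, c} \<in> E \<and> {c, b} \<in> E \<and> {b, a} \<in> E}"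
    unfolding set_eq_iff paths_iff[OF assms] len
    by (auto simp del: distinct.simps dest: V)
  show "paths V E 4 = {[e, d, c, b, a] | a b c d e. distinct [e, d, c, b, a]
           \<and> {e, d} \<in> E \<and> {d, c} \<in> E \<and> {c, b} \<in> E \<and> {b, a} \<in> E}"
    unfolding set_eq_iff paths_iff[OF assms] len
    by (auto simp del: distinct.simps dest: V)
qed

lemma sum_chord_cycles:
  assumes G: "simple_graph V E"
  shows "(\<Sum>p\<in>paths V E 2. chord E 0 2 p) = 6 * real (num_cycles V E 3)"
    and "(\<Sum>p\<in>paths V E 3. chord E 0 3 p) = 8 * real (num_cycles V E 4)"
    and "(\<Sum>p\<in>paths V E 4. chord E 0 4 p) = 10 * real (num_cycles V E 5)"
proof -
  have sum_chord: "(\<Sum>p\<in>paths V E k. chord E i j p)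
      = real (card {p \<in> paths V E k. {p ! i, p ! j} \<in> E})" for i j k
    using finite_paths[OF G, of k] by (simp add: chord_def of_bool_def sum.If_cases Int_def)
  have "{p \<in> paths V E 2. {p ! 0, p ! 2} \<in> E} = embeddings 3 (cycle_edges 3) E"
    unfolding paths_explicit[OF G] embeddings_cycle_Q
    by (auto simp: insert_commute simp del: distinct.simps)
  then show "(\<Sum>p\<in>paths V E 2. chord E 0 2 p) = 6 * real (num_cycles V E 3)"
    by (simp add: sum_chord card_embeddings_cycle_Q[OF G])
  have "{p \<in> paths V E 3. {p ! 0, p ! 3} \<in> E} = embeddings 4 (cycle_edges 4) E"
    unfolding paths_explicit[OF G] embeddings_cycle_Q
    by (auto simp: insert_commute simp del: distinct.simps)
  then show "(\<Sum>p\<in>paths V E 3. chord E 0 3 p) = 8 * real (num_cycles V E 4)"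
    by (simp add: sum_chord card_embeddings_cycle_Q[OF G])
  have "{p \<in> paths V E 4. {p ! 0, p ! 4} \<in> E} = embeddings 5 (cycle_edges 5) E"
    unfolding paths_explicit[OF G] embeddings_cycle_Q
    by (auto simp: insert_commute simp del: distinct.simps)
  then show "(\<Sum>p\<in>paths V E 4. chord E 0 4 p) = 10 * real (num_cycles V E 5)"
    by (simp add: sum_chord card_embeddings_cycle_Q[OF G])
qed

lemma sum_chord_pairs_Q:
  assumes G: "simple_graph V E"
  shows "(\<Sum>p\<in>paths V E 3. chord E 0 2 p * chord E 0 3 p) = 4 * real (num_Q V E)"
    and "(\<Sum>p\<in>paths V E 3. chord E 1 3 p * chord E 0 2 p) = 4 * real (num_Q V E)"
proof -
  have Q: "4 * real (num_Q V E) = (\<Sum>x\<in>embeddings 4 Q_edges E. 1)"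
    by (simp add: card_embeddings_cycle_Q[OF G])
  have chords: "(\<Sum>p\<in>paths V E 3. chord E i j p * chord E k l p)
      = (\<Sum>p\<in>{p \<in> paths V E 3. {p ! i, p ! j} \<in> E \<and> {p ! k, p ! l} \<in> E}. 1)" for i j k l
  proof -
    have "chord E i j p * chord E k l p = of_bool ({p ! i, p ! j} \<in> E \<and> {p ! k, p ! l} \<in> E)" for p
      by (simp add: chord_def)
    then show ?thesis
      using finite_paths[OF G, of 3] by (simp add: of_bool_def sum.If_cases Int_def)
  qed
  show "(\<Sum>p\<in>paths V E 3. chord E 0 2 p * chord E 0 3 p) = 4 * real (num_Q V E)"
    unfolding chords unfolding Q paths_explicit[OF G] embeddings_cycle_Q
    by (rule sum.reindex_bij_witness[of _ "\<lambda>x. [x ! 0, x ! 2, x ! 1, x ! 3]"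
          "\<lambda>p. [p ! 0, p ! 2, p ! 1, p ! 3]"]) (auto simp: insert_commute)
  show "(\<Sum>p\<in>paths V E 3. chord E 1 3 p * chord E 0 2 p) = 4 * real (num_Q V E)"
    unfolding chords unfolding Q paths_explicit[OF G] embeddings_cycle_Q
    by (rule sum.reindex_bij_witness[of _ "\<lambda>x. [x ! 2, x ! 0, x ! 1, x ! 3]"
          "\<lambda>p. [p ! 1, p ! 2, p ! 0, p ! 3]"]) (auto simp: insert_commute)
qed

text \<open>For a path \<open>[b, a]\<close> the inner sum counts the triangles on the edge \<open>{a, b}\<close>. The square counts pairs
  of them: equal pairs give directed triangles with a starting point, unequal pairs give the
  embeddings of \<open>Q\<close> whose edge between the two vertices of degree three is \<open>(b, a)\<close>.\<close>

lemma sum_triangles_square: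
  assumes G: "simple_graph V E"
  shows "(\<Sum>p\<in>paths V E 1. (\<Sum>u\<in>nbrs E (hd p) - set p. chord E 0 2 (u # p))\<^sup>2)
    = 6 * real (num_cycles V E 3) + 4 * real (num_Q V E)"
proof -
  let ?ext = "\<lambda>p. nbrs E (hd p) - set p"
  let ?Pairs = "SIGMA p:paths V E 1. SIGMA u:?ext p. ?ext p - {u}"
  have fin: "finite (?ext p)" "finite (paths V E 1)" for p
    using finite_nbrs[OF G] finite_paths[OF G, of 1] by auto
  have finPairs: "finite ?Pairs" using fin by (intro finite_SigmaI) auto
  define Q where "Q = (\<lambda>(p, u, v). {u, p ! 1} \<in> E \<and> {v, p ! 1} \<in> E)"
  have "(\<Sum>u\<in>?ext p. chord E 0 2 (u # p))\<^sup>2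
      = (\<Sum>u\<in>?ext p. chord E 0 2 (u # p))
        + (\<Sum>u\<in>?ext p. \<Sum>v\<in>?ext p - {u}. chord E 0 2 (u # p) * chord E 0 2 (v # p))" for p
  proof -
    have "(\<Sum>u\<in>?ext p. chord E 0 2 (u # p))\<^sup>2
        = (\<Sum>u\<in>?ext p. \<Sum>v\<in>?ext p. chord E 0 2 (u # p) * chord E 0 2 (v # p))"
      by (simp add: power2_eq_square sum_product)
    also have "\<dots> = (\<Sum>u\<in>?ext p. chord E 0 2 (u # p)
        + (\<Sum>v\<in>?ext p - {u}. chord E 0 2 (u # p) * chord E 0 2 (v # p)))"
      using fin by (intro sum.cong refl) (subst sum.remove, auto)
    finally show ?thesis by (simp add: sum.distrib)
  qed
  then have "(\<Sum>p\<in>paths V E 1. (\<Sum>u\<in>?ext p. chord E 0 2 (u # p))\<^sup>2)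
      = (\<Sum>p\<in>paths V E 2. chord E 0 2 p)
        + (\<Sum>p\<in>paths V E 1. \<Sum>u\<in>?ext p. \<Sum>v\<in>?ext p - {u}. chord E 0 2 (u # p) * chord E 0 2 (v # p))"
    using sum_paths_Suc[OF G, where k = 1 and f = "chord E 0 2"]
    by (simp add: sum.distrib numeral_2_eq_2)
  also have "(\<Sum>p\<in>paths V E 1. \<Sum>u\<in>?ext p. \<Sum>v\<in>?ext p - {u}. chord E 0 2 (u # p) * chord E 0 2 (v # p))
      = (\<Sum>(p, u, v)\<in>?Pairs. chord E 0 2 (u # p) * chord E 0 2 (v # p))"
    using fin by (simp add: sum.Sigma)
  also have "\<dots> = (\<Sum>x\<in>?Pairs. of_bool (Q x))"
    by (intro sum.cong refl) (auto simp: Q_def chord_def)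
  also have "\<dots> = (\<Sum>x\<in>{x \<in> ?Pairs. Q x}. 1)"
    using finPairs by (simp add: of_bool_def sum.If_cases Int_def)
  also have "\<dots> = (\<Sum>x\<in>embeddings 4 Q_edges E. 1)"
    by (rule sum.reindex_bij_witness[of _ "\<lambda>x. ([x ! 0, x ! 1], x ! 2, x ! 3)"
          "\<lambda>(p, u, v). [p ! 0, p ! 1, u, v]"])
      (auto simp: Q_def paths_explicit(1)[OF G, unfolded One_nat_def] embeddings_cycle_Q nbrs_def
        insert_commute)
  also have "\<dots> = 4 * real (num_Q V E)" by (simp add: card_embeddings_cycle_Q[OF G])
  finally show ?thesis using sum_chord_cycles[OF G] by simp
qed

text \<open>A path fails to extend to a neighbour of its end exactly when the neighbour is already on the
  path. The term \<open>i = 1\<close> is the last edge of the path, the terms \<open>i \<ge> 2\<close> are chords and close short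
  cycles.\<close>

lemma card_extensions:
  assumes reg: "regular_graph d V E" and p: "p \<in> paths V E k"
  shows "real (card (nbrs E (hd p) - set p)) = real d - (\<Sum>i\<le>k. chord E 0 i p)"
proof -
  have G: "simple_graph V E" using reg by (simp add: regular_graph_def)
  have len: "length p = Suc k" and dist: "distinct p" and "set p \<subseteq> V"
    using p by (auto simp: paths_iff[OF G])
  then have "p \<noteq> []" by auto
  then have "hd p \<in> V" and hd: "hd p = p ! 0" using \<open>set p \<subseteq> V\<close> by (auto simp: hd_conv_nth)
  then have deg: "card {e \<in> E. hd p \<in> e} = d"
    using reg by (simp add: regular_graph_def degree_def)
  have "bij_betw (\<lambda>u. {hd p, u}) (nbrs E (hd p)) {e \<in> E. hd p \<in> e}"
    unfolding bij_betw_def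
  proof
    show "inj_on (\<lambda>u. {hd p, u}) (nbrs E (hd p))" by (auto simp: inj_on_def doubleton_eq_iff)
    have "\<exists>u. e = {hd p, u}" if "e \<in> E" "hd p \<in> e" for e
      using edge_at_vertex[OF G that] by metis
    then show "(\<lambda>u. {hd p, u}) ` nbrs E (hd p) = {e \<in> E. hd p \<in> e}"
      by (fastforce simp: nbrs_def)
  qed
  then have card_nbrs: "card (nbrs E (hd p)) = d"
    using bij_betw_same_card deg by fastforce
  have "nbrs E (hd p) \<inter> set p = (!) p ` {i \<in> {..k}. {p ! 0, p ! i} \<in> E}"
    by (auto simp: nbrs_def hd len in_set_conv_nth less_Suc_eq_le)
  moreover have "inj_on ((!) p) {i \<in> {..k}. {p ! 0, p ! i} \<in> E}"
    using dist len by (intro inj_on_nth) auto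
  ultimately have "card (nbrs E (hd p) \<inter> set p) = card {i \<in> {..k}. {p ! 0, p ! i} \<in> E}"
    by (simp add: card_image)
  then have "real (card (nbrs E (hd p) \<inter> set p)) = (\<Sum>i\<le>k. chord E 0 i p)"
    by (simp add: chord_def of_bool_def sum.If_cases Int_def)
  moreover have "card (nbrs E (hd p)) = card (nbrs E (hd p) - set p) + card (nbrs E (hd p) \<inter> set p)"
    using finite_nbrs[OF G] by (metis add.commute card_Int_Diff)
  ultimately show ?thesis using card_nbrs by simp
qed

lemma chord_trivial:
  assumes G: "simple_graph V E" and p: "p \<in> paths V E k"
  shows "chord E 0 0 p = 0" and "k \<ge> 1 \<Longrightarrow> chord E 0 (Suc 0) p = 1"
proof -
  show "chord E 0 0 p = 0"
    using G by (auto simp: chord_def simple_graph_def)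
  assume "k \<ge> 1"
  then obtain a b q where "p = a # b # q" using p by (auto simp: paths_iff[OF G] length_Suc_conv Suc_le_eq gr0_conv_Suc)
  then show "chord E 0 (Suc 0) p = 1" using p by (simp add: paths_iff[OF G] chord_def)
qed

lemma num_extensions:
  assumes reg: "regular_graph d V E"
  defines "s \<equiv> real d - 1" and "x \<equiv> \<lambda>p. real (card (nbrs E (hd p) - set p))"
  shows "p \<in> paths V E 0 \<Longrightarrow> x p = real d"
    and "p \<in> paths V E 1 \<Longrightarrow> x p = s"
    and "p \<in> paths V E 2 \<Longrightarrow> x p = s - chord E 0 2 p"
    and "p \<in> paths V E 3 \<Longrightarrow> x p = s - chord E 0 2 p - chord E 0 3 p"
    and "p \<in> paths V E 4 \<Longrightarrow> x p = s - chord E 0 2 p - chord E 0 3 p - chord E 0 4 p"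
proof -
  have G: "simple_graph V E" using reg by (simp add: regular_graph_def)
  note e = card_extensions[OF reg] chord_trivial[OF G]
  show "p \<in> paths V E 0 \<Longrightarrow> x p = real d"
    using e[of p 0] by (simp add: x_def)
  show "p \<in> paths V E 1 \<Longrightarrow> x p = s"
    using e[of p 1] by (simp add: x_def s_def)
  show "p \<in> paths V E 2 \<Longrightarrow> x p = s - chord E 0 2 p"
    using e[of p 2] by (simp add: x_def s_def numeral_eq_Suc)
  show "p \<in> paths V E 3 \<Longrightarrow> x p = s - chord E 0 2 p - chord E 0 3 p"
    using e[of p 3] by (simp add: x_def s_def numeral_eq_Suc)
  show "p \<in> paths V E 4 \<Longrightarrow> x p = s - chord E 0 2 p - chord E 0 3 p - chord E 0 4 p"
    using e[of p 4] by (simp add: x_def s_def numeral_eq_Suc)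
qed

section \<open>Closed walks in a regular graph\<close>

text \<open>The recursion solved for \<open>walks E k p\<close> in terms of the children of \<open>p\<close>: the coefficients of
  \<open>1 / (1 - (B 0 * t + B 1 * t ^ 2 + \<dots>))\<close>.\<close>

lemma walks_unfold:
  fixes p :: "'a list" and E :: "'a set set"
  defines "B \<equiv> \<lambda>i. \<Sum>u\<in>nbrs E (hd p) - set p. walks E i (u # p)"
  shows "walks E 1 p = B 0"
    and "walks E 2 p = B 1 + B 0 ^ 2"
    and "walks E 3 p = B 2 + 2 * B 0 * B 1 + B 0 ^ 3"
    and "walks E 4 p = B 3 + 2 * B 0 * B 2 + B 1 ^ 2 + 3 * B 0 ^ 2 * B 1 + B 0 ^ 4"
    and "walks E 5 p = B 4 + 2 * B 0 * B 3 + 2 * B 1 * B 2 + 3 * B 0 ^ 2 * B 2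
           + 3 * B 0 * B 1 ^ 2 + 4 * B 0 ^ 3 * B 1 + B 0 ^ 5"
proof -
  have rec: "walks E (Suc k) p = (\<Sum>i\<le>k. B i * walks E (k - i) p)" for k
    by (simp add: B_def)
  note walks.simps(2) [simp del]
  have w0: "walks E 0 p = 1" by simp
  show w1: "walks E 1 p = B 0"
    using rec[of 0] w0 by simp
  show w2: "walks E 2 p = B 1 + B 0 ^ 2"
    using rec[of 1] w0 w1 by (simp add: numeral_2_eq_2)
  show w3: "walks E 3 p = B 2 + 2 * B 0 * B 1 + B 0 ^ 3"
  proof -
    have "walks E 3 p = B 0 * walks E 2 p + B 1 * walks E 1 p + B 2 * walks E 0 p"
      using rec[of 2] by (simp add: eval_nat_numeral)
    then show ?thesis unfolding w0 w1 w2 by algebra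
  qed
  show w4: "walks E 4 p = B 3 + 2 * B 0 * B 2 + B 1 ^ 2 + 3 * B 0 ^ 2 * B 1 + B 0 ^ 4"
  proof -
    have "walks E 4 p = B 0 * walks E 3 p + B 1 * walks E 2 p + B 2 * walks E 1 p + B 3 * walks E 0 p"
      using rec[of 3] by (simp add: eval_nat_numeral)
    then show ?thesis unfolding w0 w1 w2 w3 by algebra
  qed
  show "walks E 5 p = B 4 + 2 * B 0 * B 3 + 2 * B 1 * B 2 + 3 * B 0 ^ 2 * B 2
           + 3 * B 0 * B 1 ^ 2 + 4 * B 0 ^ 3 * B 1 + B 0 ^ 5"
  proof -
    have "walks E 5 p = B 0 * walks E 4 p + B 1 * walks E 3 p + B 2 * walks E 2 p
        + B 3 * walks E 1 p + B 4 * walks E 0 p"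
      using rec[of 4] by (simp add: eval_nat_numeral)
    then show ?thesis unfolding w0 w1 w2 w3 w4 by algebra
  qed
qed

declare walks.simps [simp del]

locale regular_counting =
  fixes V :: "'a set" and E :: "'a set set" and d :: nat
  assumes reg: "regular_graph d V E"
begin

abbreviation path_sum :: "nat \<Rightarrow> ('a list \<Rightarrow> real) \<Rightarrow> real" where
  "path_sum k f \<equiv> \<Sum>p\<in>paths V E k. f p"

abbreviation ch :: "nat \<Rightarrow> nat \<Rightarrow> 'a list \<Rightarrow> real" where
  "ch \<equiv> chord E"

abbreviation n :: real where "n \<equiv> real (card V)"
abbreviation r :: real where "r \<equiv> real d"

text \<open>The number of children of a node of the path tree that is not the root and at which no chord
  ends.\<close>

definition s :: real where "s = r - 1"

abbreviation c3 :: real where "c3 \<equiv> real (num_cycles V E 3)"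
abbreviation c4 :: real where "c4 \<equiv> real (num_cycles V E 4)"
abbreviation c5 :: real where "c5 \<equiv> real (num_cycles V E 5)"
abbreviation q :: real where "q \<equiv> real (num_Q V E)"

lemma graph: "simple_graph V E"
  using reg by (simp add: regular_graph_def)

lemmas extensions = num_extensions[OF reg, folded s_def]

abbreviation up :: "nat \<Rightarrow> 'a list \<Rightarrow> real" where
  "up i p \<equiv> \<Sum>u\<in>nbrs E (hd p) - set p. walks E i (u # p)"

lemma up_0: "up 0 p = real (card (nbrs E (hd p) - set p))"
  by (simp add: walks.simps)

lemma walks_1: "walks E 1 p = real (card (nbrs E (hd p) - set p))"
  unfolding walks_unfold by (rule up_0)

text \<open>Sums over children move to the next level; this turns the nested sums in the unfolded walk
  recursion into sums over longer paths.\<close>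

lemma path_sum_up: "path_sum k (up i) = path_sum (Suc k) (walks E i)"
  by (simp add: sum_paths_Suc[OF graph])

lemma path_sum_chord_Suc:
  assumes "\<And>p. p \<in> paths V E k \<Longrightarrow> real (card (nbrs E (hd p) - set p)) = x p"
  shows "path_sum (Suc k) (ch (Suc i) (Suc j)) = path_sum k (\<lambda>p. x p * ch i j p)"
  using assms by (simp add: sum_paths_Suc[OF graph])

text \<open>Reversing the paths moves a chord at the last vertex to one at the first vertex, where the number
  of extensions of the remaining path is known.\<close>

lemma path_sum_chord_rev:
  assumes "i \<le> k" "j \<le> k"
  shows "path_sum k (ch i j) = path_sum k (ch (k - j) (k - i))"
proof -
  have "path_sum k (ch i j) = path_sum k (\<lambda>p. ch i j (rev p))" by (rule sum_paths_rev[OF graph])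
  also have "\<dots> = path_sum k (ch (k - j) (k - i))"
    using assms by (intro sum.cong refl) (rule chord_rev[OF graph])
  finally show ?thesis .
qed

lemmas chords_full = sum_chord_cycles[OF graph]

lemma chords_3:
  "path_sum 3 (ch 1 3) = 6 * (s - 1) * c3"
  "path_sum 3 (ch 0 2) = 6 * (s - 1) * c3"
proof -
  have "path_sum 3 (ch 1 3) = path_sum 2 (\<lambda>p. (s - ch 0 2 p) * ch 0 2 p)"
    using path_sum_chord_Suc[OF extensions(3), where i = 0 and j = 2] by (simp add: eval_nat_numeral)
  also have "\<dots> = path_sum 2 (\<lambda>p. (s - 1) * ch 0 2 p)"
    by (intro sum.cong refl) (simp add: algebra_simps)
  also have "\<dots> = 6 * (s - 1) * c3" by (simp add: chords_full flip: sum_distrib_left)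
  finally show "path_sum 3 (ch 1 3) = 6 * (s - 1) * c3" .
  then show "path_sum 3 (ch 0 2) = 6 * (s - 1) * c3"
    using path_sum_chord_rev[of 0 3 2] by simp
qed

definition num_paths_4 :: real where
  "num_paths_4 = s * (n * r * s\<^sup>2 - 6 * c3) - 6 * (s - 1) * c3 - 8 * c4"

lemma num_paths:
  "real (card (paths V E 0)) = n"
  "real (card (paths V E 1)) = n * r"
  "real (card (paths V E 2)) = n * r * s"
  "real (card (paths V E 3)) = n * r * s\<^sup>2 - 6 * c3"
  "real (card (paths V E 4)) = num_paths_4"
proof -
  have Suc: "real (card (paths V E (Suc k))) = path_sum k x"
    if "\<And>p. p \<in> paths V E k \<Longrightarrow> real (card (nbrs E (hd p) - set p)) = x p" for k x
    using sum_paths_Suc[OF graph, where k = k and f = "\<lambda>_. 1 :: real"] that by simp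
  show 0: "real (card (paths V E 0)) = n"
    by (simp add: paths.simps card_image inj_on_def)
  show 1: "real (card (paths V E 1)) = n * r"
    using Suc[OF extensions(1)] 0 by simp
  show 2: "real (card (paths V E 2)) = n * r * s"
    using Suc[OF extensions(2)] 1 by (simp add: eval_nat_numeral)
  show 3: "real (card (paths V E 3)) = n * r * s\<^sup>2 - 6 * c3"
    using Suc[OF extensions(3)] 2 chords_full(1)
    by (simp add: eval_nat_numeral sum_subtractf mult.assoc)
  have "real (card (paths V E 4)) = path_sum 3 (\<lambda>p. s - ch 0 2 p - ch 0 3 p)"
    using Suc[where k = 3, OF extensions(4)] by (simp add: eval_nat_numeral)
  then show "real (card (paths V E 4)) = num_paths_4"
    by (simp add: num_paths_4_def sum_subtractf 3 chords_full chords_3 mult.commute)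
qed

text \<open>Two of the three chords of a path on four vertices, together with its edges, form a copy of \<open>Q\<close>.\<close>

lemma chord_pairs_3:
  "path_sum 3 (\<lambda>p. ch 0 2 p * ch 0 3 p) = 4 * q"
  "path_sum 3 (\<lambda>p. ch 1 3 p * ch 0 2 p) = 4 * q"
  "path_sum 3 (\<lambda>p. ch 1 3 p * ch 0 3 p) = 4 * q"
proof -
  show 1: "path_sum 3 (\<lambda>p. ch 0 2 p * ch 0 3 p) = 4 * q" and "path_sum 3 (\<lambda>p. ch 1 3 p * ch 0 2 p) = 4 * q"
    using sum_chord_pairs_Q[OF graph] by simp_all
  have "path_sum 3 (\<lambda>p. ch 1 3 p * ch 0 3 p) = path_sum 3 (\<lambda>p. ch 1 3 (rev p) * ch 0 3 (rev p))"
    by (rule sum_paths_rev[OF graph])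
  also have "\<dots> = path_sum 3 (\<lambda>p. ch 0 2 p * ch 0 3 p)"
    by (intro sum.cong refl) (simp add: chord_rev[OF graph, where k = 3])
  finally show "path_sum 3 (\<lambda>p. ch 1 3 p * ch 0 3 p) = 4 * q" using 1 by simp
qed

text \<open>After reversal the chord avoids the newest vertex, so it is a chord of the path without it. The
  number of extensions of that path drops with the further chords at its end, which produces \<open>Q\<close>.\<close>

lemma chords_4:
  "path_sum 4 (ch 0 3) = 8 * (s - 1) * c4 - 4 * q"
  "path_sum 4 (ch 0 2) = 6 * s * (s - 1) * c3 - 8 * q"
proof -
  have "path_sum 4 (ch 1 4) = path_sum 3 (\<lambda>p. (s - ch 0 2 p - ch 0 3 p) * ch 0 3 p)"
    using path_sum_chord_Suc[OF extensions(4), where i = 0 and j = 3] by (simp add: eval_nat_numeral)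
  also have "\<dots> = path_sum 3 (\<lambda>p. (s - 1) * ch 0 3 p - ch 0 2 p * ch 0 3 p)"
    by (intro sum.cong refl) (simp add: algebra_simps)
  also have "\<dots> = 8 * (s - 1) * c4 - 4 * q"
    by (simp add: chords_full chord_pairs_3 sum_subtractf flip: sum_distrib_left)
  finally show "path_sum 4 (ch 0 3) = 8 * (s - 1) * c4 - 4 * q"
    using path_sum_chord_rev[of 0 4 3] by simp
  have "path_sum 4 (ch 2 4) = path_sum 3 (\<lambda>p. (s - ch 0 2 p - ch 0 3 p) * ch 1 3 p)"
    using path_sum_chord_Suc[OF extensions(4), where i = 1 and j = 3] by (simp add: eval_nat_numeral)
  also have "\<dots> = path_sum 3 (\<lambda>p. s * ch 1 3 p - ch 1 3 p * ch 0 2 p - ch 1 3 p * ch 0 3 p)"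
    by (intro sum.cong refl) (simp add: algebra_simps)
  also have "\<dots> = 6 * s * (s - 1) * c3 - 8 * q"
    unfolding sum_subtractf sum_distrib_left[symmetric] chords_3 chord_pairs_3 by algebra
  finally show "path_sum 4 (ch 0 2) = 6 * s * (s - 1) * c3 - 8 * q"
    using path_sum_chord_rev[of 0 4 2] by simp
qed

lemma path_sum_4_walks:
  "path_sum 4 (walks E 1) = s * num_paths_4 - (6 * s * (s - 1) * c3 - 8 * q) - (8 * (s - 1) * c4 - 4 * q) - 10 * c5"
proof -
  have "path_sum 4 (walks E 1) = path_sum 4 (\<lambda>p. s - ch 0 2 p - ch 0 3 p - ch 0 4 p)"
    unfolding walks_1 by (intro sum.cong refl extensions)
  then show ?thesis
    by (simp add: sum_subtractf chords_4 chords_full num_paths num_paths_4_def mult.commute)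
qed

lemma path_sum_3_walks:
  "path_sum 3 (walks E 1) = num_paths_4"
  "path_sum 3 (walks E 2) = path_sum 4 (walks E 1) + s\<^sup>2 * (n * r * s\<^sup>2 - 6 * c3)
     + (1 - 2 * s) * (6 * (s - 1) * c3 + 8 * c4) + 8 * q"
proof -
  have "path_sum 3 (walks E 1) = path_sum 3 (\<lambda>p. s - ch 0 2 p - ch 0 3 p)"
    unfolding walks_1 by (intro sum.cong refl extensions)
  then show "path_sum 3 (walks E 1) = num_paths_4"
    by (simp add: sum_subtractf chords_3 chords_full num_paths num_paths_4_def mult.commute)
  have "path_sum 3 (walks E 2) = path_sum 3 (\<lambda>p. up 1 p + (s - ch 0 2 p - ch 0 3 p)\<^sup>2)"
    by (intro sum.cong refl) (subst walks_unfold(2), simp only: up_0 extensions)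
  also have "\<dots> = path_sum 3 (\<lambda>p. up 1 p + (s\<^sup>2 + (1 - 2 * s) * ch 0 2 p + (1 - 2 * s) * ch 0 3 p
      + 2 * (ch 0 2 p * ch 0 3 p)))"
    by (intro sum.cong refl arg_cong2[of _ _ _ _ "(+)"]) (simp add: power2_eq_square algebra_simps)
  also have "\<dots> = path_sum 4 (walks E 1) + s\<^sup>2 * (n * r * s\<^sup>2 - 6 * c3)
     + (1 - 2 * s) * (6 * (s - 1) * c3 + 8 * c4) + 8 * q"
    using path_sum_up[where k = 3 and i = 1] unfolding sum.distrib sum_distrib_left[symmetric]
    by (simp add: chords_3 chords_full chord_pairs_3 num_paths algebra_simps)
  finally show "path_sum 3 (walks E 2) = \<dots>" .
qed

lemma path_sum_2_walks:
  "path_sum 2 (walks E 1) = n * r * s\<^sup>2 - 6 * c3"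
  "path_sum 2 (walks E 2) = num_paths_4 + n * r * s ^ 3 + 6 * (1 - 2 * s) * c3"
  "path_sum 2 (walks E 3) = path_sum 3 (walks E 2)
     + 2 * (s\<^sup>2 * (n * r * s\<^sup>2 - 6 * c3) - 12 * s * (s - 1) * c3 - 8 * s * c4 + 8 * q)
     + n * r * s ^ 4 + 6 * (3 * s - 3 * s\<^sup>2 - 1) * c3"
proof -
  have "path_sum 2 (walks E 1) = path_sum 2 (\<lambda>p. s - ch 0 2 p)"
    unfolding walks_1 by (intro sum.cong refl extensions)
  then show "path_sum 2 (walks E 1) = n * r * s\<^sup>2 - 6 * c3"
    by (simp add: sum_subtractf chords_full num_paths power2_eq_square mult.commute mult.left_commute)
  have "path_sum 2 (walks E 2) = path_sum 2 (\<lambda>p. up 1 p + (s - ch 0 2 p)\<^sup>2)"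
    by (intro sum.cong refl) (subst walks_unfold(2), simp only: up_0 extensions)
  also have "\<dots> = path_sum 2 (\<lambda>p. up 1 p + (s\<^sup>2 + (1 - 2 * s) * ch 0 2 p))"
    by (intro sum.cong refl arg_cong2[of _ _ _ _ "(+)"]) (simp add: power2_eq_square algebra_simps)
  also have "\<dots> = num_paths_4 + n * r * s ^ 3 + 6 * (1 - 2 * s) * c3"
    using path_sum_up[where k = 2 and i = 1] path_sum_3_walks(1) unfolding sum.distrib sum_distrib_left[symmetric]
    by (simp add: chords_full num_paths power2_eq_square power3_eq_cube)
  finally show "path_sum 2 (walks E 2) = \<dots>" .
  \<comment> \<open>On a longer path the factor of its parent refers to the chord one step further back.\<close>
  have "path_sum 2 (\<lambda>p. up 0 p * up 1 p) = path_sum 2 (\<lambda>p. (s - ch 0 2 p) * up 1 p)"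
    unfolding up_0 by (intro sum.cong refl) (simp add: extensions)
  also have "\<dots> = path_sum 3 (\<lambda>p. (s - ch 1 3 p) * walks E 1 p)"
    using sum_paths_Suc[OF graph, where k = 2 and f = "\<lambda>p. (s - ch 1 3 p) * walks E 1 p"]
    by (simp add: sum_distrib_left eval_nat_numeral)
  also have "\<dots> = path_sum 3 (\<lambda>p. (s - ch 1 3 p) * (s - ch 0 2 p - ch 0 3 p))"
    unfolding walks_1 by (intro sum.cong refl) (simp add: extensions)
  also have "\<dots> = path_sum 3 (\<lambda>p. s\<^sup>2 - s * ch 0 2 p - s * ch 0 3 p - s * ch 1 3 p
      + ch 1 3 p * ch 0 2 p + ch 1 3 p * ch 0 3 p)"
    by (intro sum.cong refl) (simp add: power2_eq_square algebra_simps)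
  also have "\<dots> = s\<^sup>2 * (n * r * s\<^sup>2 - 6 * c3) - 12 * s * (s - 1) * c3 - 8 * s * c4 + 8 * q"
    unfolding sum.distrib sum_subtractf sum_distrib_left[symmetric] chords_3 chords_full chord_pairs_3
    by (simp add: num_paths algebra_simps)
  finally have mixed: "path_sum 2 (\<lambda>p. up 0 p * up 1 p) = \<dots>" .
  have cube: "(s - x) ^ 3 = s ^ 3 + (3 * s - 3 * s\<^sup>2 - 1) * x" if "x * x = x" for x
  proof -
    have "x = 0 \<or> x = 1" using that by simp
    then show ?thesis by (elim disjE) (simp_all add: power2_eq_square power3_eq_cube algebra_simps)
  qed
  have "path_sum 2 (walks E 3) = path_sum 2 (\<lambda>p. up 2 p + 2 * (up 0 p * up 1 p) + (s - ch 0 2 p) ^ 3)"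
    by (intro sum.cong refl) (subst walks_unfold(3), simp only: up_0 extensions)
  also have "\<dots> = path_sum 2 (\<lambda>p. up 2 p + 2 * (up 0 p * up 1 p)
      + (s ^ 3 + (3 * s - 3 * s\<^sup>2 - 1) * ch 0 2 p))"
    by (intro sum.cong refl arg_cong2[of _ _ _ _ "(+)"] cube) simp
  also have "\<dots> = path_sum 3 (walks E 2)
     + 2 * (s\<^sup>2 * (n * r * s\<^sup>2 - 6 * c3) - 12 * s * (s - 1) * c3 - 8 * s * c4 + 8 * q)
     + n * r * s ^ 4 + 6 * (3 * s - 3 * s\<^sup>2 - 1) * c3"
    using path_sum_up[where k = 2 and i = 2] unfolding sum.distrib sum_distrib_left[symmetric] mixed
    by (simp add: chords_full num_paths power3_eq_cube power4_eq_xxxx)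
  finally show "path_sum 2 (walks E 3) = \<dots>" .
qed

text \<open>On paths with one edge the number of children is constant, and the only nonlinear term left is the
  square of \<open>up 1\<close>. It contains the squared number of triangles on an edge, which is how \<open>Q\<close> enters
  a second time.\<close>

lemma path_sum_1_walks:
  "path_sum 1 (walks E 1) = n * r * s"
  "path_sum 1 (walks E 2) = path_sum 2 (walks E 1) + n * r * s\<^sup>2"
  "path_sum 1 (walks E 3) = path_sum 2 (walks E 2) + 2 * s * path_sum 2 (walks E 1) + n * r * s ^ 3"
  "path_sum 1 (walks E 4) = path_sum 2 (walks E 3) + 2 * s * path_sum 2 (walks E 2) + 3 * s\<^sup>2 * path_sum 2 (walks E 1)
     + n * r * s ^ 4 + (n * r * s ^ 4 - 12 * s\<^sup>2 * c3 + 6 * c3 + 4 * q)"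
proof -
  note up = path_sum_up[where k = 1, unfolded Suc_1]
  have up_0': "up 0 p = s" if "p \<in> paths V E 1" for p
    unfolding up_0 using extensions(2)[OF that] .
  have "path_sum 1 (walks E 1) = path_sum 1 (\<lambda>p. s)"
    unfolding walks_unfold by (intro sum.cong refl up_0')
  then show "path_sum 1 (walks E 1) = n * r * s"
    using num_paths by simp
  have "path_sum 1 (walks E 2) = path_sum 1 (\<lambda>p. up 1 p + s\<^sup>2)"
    by (intro sum.cong refl) (subst walks_unfold(2), simp only: up_0')
  then show "path_sum 1 (walks E 2) = path_sum 2 (walks E 1) + n * r * s\<^sup>2"
    unfolding sum.distrib up using num_paths by simp
  have "path_sum 1 (walks E 3) = path_sum 1 (\<lambda>p. up 2 p + 2 * s * up 1 p + s ^ 3)"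
    by (intro sum.cong refl) (subst walks_unfold(3), simp only: up_0')
  then show "path_sum 1 (walks E 3) = path_sum 2 (walks E 2) + 2 * s * path_sum 2 (walks E 1) + n * r * s ^ 3"
    unfolding sum.distrib sum_distrib_left[symmetric] up using num_paths by simp
  define T where "T p = (\<Sum>u\<in>nbrs E (hd p) - set p. ch 0 2 (u # p))" for p
  have up_1: "up 1 p = s\<^sup>2 - T p" if p: "p \<in> paths V E 1" for p
  proof -
    have "walks E 1 (u # p) = s - ch 0 2 (u # p)" if "u \<in> nbrs E (hd p) - set p" for u
    proof -
      have "u # p \<in> paths V E 2" using p that by (auto simp: numeral_2_eq_2 paths.simps(2)[of _ _ "Suc 0"])
      then show ?thesis unfolding walks_1 by (rule extensions)
    qed
    then have "up 1 p = real (card (nbrs E (hd p) - set p)) * s - T p"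
      by (simp add: T_def sum_subtractf)
    then show ?thesis using extensions(2)[OF p] by (simp add: power2_eq_square)
  qed
  have "path_sum 1 T = 6 * c3"
    using sum_paths_Suc[OF graph, where k = 1 and f = "ch 0 2"] chords_full(1)
    by (simp add: T_def numeral_2_eq_2)
  moreover have "path_sum 1 (\<lambda>p. (T p)\<^sup>2) = 6 * c3 + 4 * q"
    unfolding T_def by (rule sum_triangles_square[OF graph])
  moreover have "path_sum 1 (\<lambda>p. (up 1 p)\<^sup>2) = path_sum 1 (\<lambda>p. s ^ 4 - (2 * s\<^sup>2) * T p + (T p)\<^sup>2)"
    by (intro sum.cong refl) (simp only: up_1, algebra)
  ultimately have square: "path_sum 1 (\<lambda>p. (up 1 p)\<^sup>2) = n * r * s ^ 4 - 12 * s\<^sup>2 * c3 + 6 * c3 + 4 * q"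
    unfolding sum.distrib sum_subtractf sum_distrib_left[symmetric] using num_paths by simp
  have "path_sum 1 (walks E 4) = path_sum 1 (\<lambda>p. up 3 p + 2 * s * up 2 p + (up 1 p)\<^sup>2 + 3 * s\<^sup>2 * up 1 p + s ^ 4)"
    by (intro sum.cong refl) (subst walks_unfold(4), simp only: up_0')
  then show "path_sum 1 (walks E 4) = path_sum 2 (walks E 3) + 2 * s * path_sum 2 (walks E 2) + 3 * s\<^sup>2 * path_sum 2 (walks E 1)
     + n * r * s ^ 4 + (n * r * s ^ 4 - 12 * s\<^sup>2 * c3 + 6 * c3 + 4 * q)"
    unfolding sum.distrib sum_distrib_left[symmetric] up square using num_paths by simp
qed

lemma path_sum_0_walks:
  "path_sum 0 (walks E 1) = n * r"
  "path_sum 0 (walks E 2) = path_sum 1 (walks E 1) + n * r\<^sup>2"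
  "path_sum 0 (walks E 3) = path_sum 1 (walks E 2) + 2 * r * path_sum 1 (walks E 1) + n * r ^ 3"
  "path_sum 0 (walks E 4) = path_sum 1 (walks E 3) + 2 * r * path_sum 1 (walks E 2) + 3 * r\<^sup>2 * path_sum 1 (walks E 1)
     + n * r\<^sup>2 * s\<^sup>2 + n * r ^ 4"
  "path_sum 0 (walks E 5) = path_sum 1 (walks E 4) + 2 * r * path_sum 1 (walks E 3)
     + (2 * r * s + 3 * r\<^sup>2) * path_sum 1 (walks E 2)
     + 3 * n * r ^ 3 * s\<^sup>2 + 4 * n * r ^ 4 * s + n * r ^ 5"
proof -
  note up = path_sum_up[where k = 0, unfolded One_nat_def[symmetric]]
  have up_0': "up 0 p = r" if "p \<in> paths V E 0" for p
    unfolding up_0 using extensions(1)[OF that] .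
  have up_1: "up 1 p = r * s" if p: "p \<in> paths V E 0" for p
  proof -
    have "walks E 1 (u # p) = s" if "u \<in> nbrs E (hd p) - set p" for u
    proof -
      have "u # p \<in> paths V E 1" using p that by (auto simp: paths.simps(2)[of _ _ 0])
      then show ?thesis unfolding walks_1 by (rule extensions)
    qed
    then show ?thesis using extensions(1)[OF p] by simp
  qed
  have "path_sum 0 (walks E 1) = path_sum 0 (\<lambda>p. r)"
    unfolding walks_unfold by (intro sum.cong refl up_0')
  then show "path_sum 0 (walks E 1) = n * r"
    using num_paths by simp
  have "path_sum 0 (walks E 2) = path_sum 0 (\<lambda>p. up 1 p + r\<^sup>2)"
    by (intro sum.cong refl) (subst walks_unfold(2), simp only: up_0')
  then show "path_sum 0 (walks E 2) = path_sum 1 (walks E 1) + n * r\<^sup>2"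
    unfolding sum.distrib up using num_paths by simp
  have "path_sum 0 (walks E 3) = path_sum 0 (\<lambda>p. up 2 p + 2 * r * up 1 p + r ^ 3)"
    by (intro sum.cong refl) (subst walks_unfold(3), simp only: up_0')
  then show "path_sum 0 (walks E 3) = path_sum 1 (walks E 2) + 2 * r * path_sum 1 (walks E 1) + n * r ^ 3"
    unfolding sum.distrib sum_distrib_left[symmetric] up using num_paths by simp
  have "path_sum 0 (walks E 4) = path_sum 0 (\<lambda>p. up 3 p + 2 * r * up 2 p + 3 * r\<^sup>2 * up 1 p + (r\<^sup>2 * s\<^sup>2 + r ^ 4))"
  proof (intro sum.cong refl)
    fix p assume p: "p \<in> paths V E 0"
    have "walks E 4 p = up 3 p + 2 * r * up 2 p + (up 1 p)\<^sup>2 + 3 * r\<^sup>2 * up 1 p + r ^ 4"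
      by (subst walks_unfold(4)) (simp only: up_0'[OF p])
    moreover have "(up 1 p)\<^sup>2 = r\<^sup>2 * s\<^sup>2" unfolding up_1[OF p] by (rule power_mult_distrib)
    ultimately show "walks E 4 p = up 3 p + 2 * r * up 2 p + 3 * r\<^sup>2 * up 1 p + (r\<^sup>2 * s\<^sup>2 + r ^ 4)"
      by linarith
  qed
  then show "path_sum 0 (walks E 4) = path_sum 1 (walks E 3) + 2 * r * path_sum 1 (walks E 2) + 3 * r\<^sup>2 * path_sum 1 (walks E 1)
     + n * r\<^sup>2 * s\<^sup>2 + n * r ^ 4"
    unfolding sum.distrib sum_distrib_left[symmetric] up using num_paths by (simp add: algebra_simps)
  have "path_sum 0 (walks E 5) = path_sum 0 (\<lambda>p. up 4 p + 2 * r * up 3 p + (2 * r * s + 3 * r\<^sup>2) * up 2 p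
      + (3 * r ^ 3 * s\<^sup>2 + 4 * r ^ 4 * s + r ^ 5))"
  proof (intro sum.cong refl)
    fix p assume p: "p \<in> paths V E 0"
    have "walks E 5 p = up 4 p + 2 * r * up 3 p + 2 * (r * s) * up 2 p + 3 * r\<^sup>2 * up 2 p
        + 3 * r * (r * s)\<^sup>2 + 4 * r ^ 3 * (r * s) + r ^ 5"
      by (subst walks_unfold(5)) (simp only: up_0'[OF p] up_1[OF p])
    then show "walks E 5 p = up 4 p + 2 * r * up 3 p + (2 * r * s + 3 * r\<^sup>2) * up 2 p
        + (3 * r ^ 3 * s\<^sup>2 + 4 * r ^ 4 * s + r ^ 5)"
      by algebra
  qed
  then show "path_sum 0 (walks E 5) = path_sum 1 (walks E 4) + 2 * r * path_sum 1 (walks E 3)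
     + (2 * r * s + 3 * r\<^sup>2) * path_sum 1 (walks E 2)
     + 3 * n * r ^ 3 * s\<^sup>2 + 4 * n * r ^ 4 * s + n * r ^ 5"
    unfolding sum.distrib sum_distrib_left[symmetric] up using num_paths
    by (simp add: algebra_simps)
qed

definition walk_sum where "walk_sum k = path_sum 0 (walks E k)"

lemma newton:
  "2 * real (num_matchings E 1) = walk_sum 1"
  "4 * real (num_matchings E 2) = walk_sum 1 * real (num_matchings E 1) - walk_sum 2"
  "6 * real (num_matchings E 3) = walk_sum 1 * real (num_matchings E 2) - walk_sum 2 * real (num_matchings E 1) + walk_sum 3"
  "8 * real (num_matchings E 4) = walk_sum 1 * real (num_matchings E 3) - walk_sum 2 * real (num_matchings E 2)
     + walk_sum 3 * real (num_matchings E 1) - walk_sum 4"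
  "10 * real (num_matchings E 5) = walk_sum 1 * real (num_matchings E 4) - walk_sum 2 * real (num_matchings E 3)
     + walk_sum 3 * real (num_matchings E 2) - walk_sum 4 * real (num_matchings E 1) + walk_sum 5"
proof -
  have P: "(\<Sum>v\<in>V. walks E k [v]) = walk_sum k" for k
    unfolding walk_sum_def paths.simps by (subst sum.reindex) (auto simp: inj_on_def)
  note N = newton_identity[OF graph, unfolded P]
  have "num_matchings E 0 = 1" using simple_graph_finite[OF graph] by simp
  note 0 = this
  show "2 * real (num_matchings E 1) = walk_sum 1" using N[of 0] 0 by simp
  show "4 * real (num_matchings E 2) = walk_sum 1 * real (num_matchings E 1) - walk_sum 2" using N[of 1] 0 by (simp add: eval_nat_numeral)
  show "6 * real (num_matchings E 3) = walk_sum 1 * real (num_matchings E 2) - walk_sum 2 * real (num_matchings E 1) + walk_sum 3"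
    using N[of 2] 0 by (simp add: eval_nat_numeral)
  show "8 * real (num_matchings E 4) = walk_sum 1 * real (num_matchings E 3) - walk_sum 2 * real (num_matchings E 2)
     + walk_sum 3 * real (num_matchings E 1) - walk_sum 4" using N[of 3] 0 by (simp add: eval_nat_numeral)
  show "10 * real (num_matchings E 5) = walk_sum 1 * real (num_matchings E 4) - walk_sum 2 * real (num_matchings E 3)
     + walk_sum 3 * real (num_matchings E 2) - walk_sum 4 * real (num_matchings E 1) + walk_sum 5"
    using N[of 4] 0 by (simp add: eval_nat_numeral)
qed

text \<open>The expression of the fifth elementary symmetric function by power sums, rescaled because each
  \<open>walk_sum k\<close> is twice a power sum.\<close>

lemma num_matchings_5:
  "3840 * real (num_matchings E 5) = walk_sum 1 ^ 5 - 20 * walk_sum 1 ^ 3 * walk_sum 2 + 60 * walk_sum 1 * walk_sum 2 ^ 2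
     + 80 * walk_sum 1 ^ 2 * walk_sum 3 - 160 * walk_sum 2 * walk_sum 3 - 240 * walk_sum 1 * walk_sum 4 + 384 * walk_sum 5"
proof -
  have 1: "real (num_matchings E 1) = walk_sum 1 / 2"
    using newton(1) by simp
  have 2: "real (num_matchings E 2) = (walk_sum 1 ^ 2 - 2 * walk_sum 2) / 8"
    using newton(2) unfolding 1 by (simp add: power2_eq_square)
  have 3: "real (num_matchings E 3) = (walk_sum 1 ^ 3 - 6 * walk_sum 1 * walk_sum 2 + 8 * walk_sum 3) / 48"
    using newton(3) unfolding 1 2 by (simp add: field_simps power2_eq_square power3_eq_cube)
  have 4: "real (num_matchings E 4)
      = (walk_sum 1 ^ 4 - 12 * walk_sum 1 ^ 2 * walk_sum 2 + 12 * walk_sum 2 ^ 2 + 32 * walk_sum 1 * walk_sum 3 - 48 * walk_sum 4) / 384"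
    using newton(4) unfolding 1 2 3
    by (simp add: field_simps power2_eq_square power3_eq_cube power4_eq_xxxx)
  show ?thesis
    using newton(5) unfolding 1 2 3 4 by (simp add: field_simps eval_nat_numeral)
qed

text \<open>The coefficients of the pure \<open>n\<close>-\<open>r\<close> part are those of a tree, where every node except the root has
  \<open>r - 1\<close> children; short cycles prune the path tree and give the remaining terms.\<close>

lemma power_sums:
  "walk_sum 1 = n * r"
  "walk_sum 2 = 2 * n * r\<^sup>2 - n * r"
  "walk_sum 3 = 5 * n * r ^ 3 - 6 * n * r\<^sup>2 + 2 * n * r - 6 * c3"
  "walk_sum 4 = 14 * n * r ^ 4 - 28 * n * r ^ 3 + 20 * n * r\<^sup>2 - 5 * n * r - 48 * (r - 1) * c3 - 8 * c4"
  "walk_sum 5 = 42 * n * r ^ 5 - 120 * n * r ^ 4 + 135 * n * r ^ 3 - 70 * n * r\<^sup>2 + 14 * n * r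
     - 270 * (r - 1)\<^sup>2 * c3 - 80 * (r - 1) * c4 - 10 * c5 + 40 * q"
  unfolding walk_sum_def path_sum_0_walks path_sum_1_walks path_sum_2_walks path_sum_3_walks path_sum_4_walks num_paths_4_def s_def
  by algebra+

lemma num_matchings_5_regular:
  "real (num_matchings E 5) =
    n * r / 3840 *
      (n^4 * r^4 - 40 * n^3 * r^4 + 640 * n^2 * r^4 - 4960 * n * r^4 + 16128 * r^4
       + 20 * n^3 * r^3 - 720 * n^2 * r^3 + 9440 * n * r^3 - 46080 * r^3
       + 220 * n^2 * r^2 - 6400 * n * r^2 + 51840 * r^2
       + 1520 * n * r - 26880 * r + 5376)
    + (- 5 * n^2 * r^2 + 140 * n * r^2 - 1080 * r^2 - 130 * n * r + 2160 * r - 1080) / 40 * c3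
    + (n * r / 2 - 8 * r + 8) * c4 - c5 + 4 * q"
proof -
  have "3840 * real (num_matchings E 5) =
    n * r *
      (n^4 * r^4 - 40 * n^3 * r^4 + 640 * n^2 * r^4 - 4960 * n * r^4 + 16128 * r^4
       + 20 * n^3 * r^3 - 720 * n^2 * r^3 + 9440 * n * r^3 - 46080 * r^3
       + 220 * n^2 * r^2 - 6400 * n * r^2 + 51840 * r^2
       + 1520 * n * r - 26880 * r + 5376)
    + 96 * (- 5 * n^2 * r^2 + 140 * n * r^2 - 1080 * r^2 - 130 * n * r + 2160 * r - 1080) * c3
    + 1920 * (n * r - 16 * r + 16) * c4 - 3840 * c5 + 15360 * q"
    unfolding num_matchings_5 power_sums by algebra
  then show ?thesis by (simp add: field_simps)
qed

end

theorem mainTheorem1: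
  fixes V :: "'a set" and E :: "'a set set" and d :: nat and n r c3 c4 c5 q :: real
  assumes "regular_graph d V E"
    and "r = real d"
    and "n = real (card V)"
    and "c3 = real (num_cycles V E 3)"
    and "c4 = real (num_cycles V E 4)"
    and "c5 = real (num_cycles V E 5)"
    and "q = real (num_Q V E)"
  shows "real (num_matchings E 5) =
    n * r / 3840 *
      (n^4 * r^4 - 40 * n^3 * r^4 + 640 * n^2 * r^4 - 4960 * n * r^4 + 16128 * r^4
       + 20 * n^3 * r^3 - 720 * n^2 * r^3 + 9440 * n * r^3 - 46080 * r^3
       + 220 * n^2 * r^2 - 6400 * n * r^2 + 51840 * r^2
       + 1520 * n * r - 26880 * r + 5376)
    + (- 5 * n^2 * r^2 + 140 * n * r^2 - 1080 * r^2 - 130 * n * r + 2160 * r - 1080) / 40 * c3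
    + (n * r / 2 - 8 * r + 8) * c4 - c5 + 4 * q"
proof -
  interpret regular_counting V E d by unfold_locales (rule assms(1))
  show ?thesis unfolding assms(2-7) by (rule num_matchings_5_regular)
qed

end
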